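(* Let $p \colon E \to B$ be a locally trivial fibration, where $E$ is an ENR and $B$ is a separable ANR. Then $E \times_B E$ is a $\mathbb{Z}_2$-ENR, and the map $p$ is symmetrically LEC.
   Context: $E \times_B E = \{(e_1,e_2) \in E \times E \mid p(e_1)=p(e_2)\}$, with $\mathbb{Z}_2$ acting by transposition $(e_1,e_2) \mapsto (e_2,e_1)$. The diagonal inclusion is $\Delta_E \colon E \to E \times_B E$, $e \mapsto (e,e)$. For a compact Lie group $G$, a $G$-space $X$ is a $G$-ENR if there exist a finite-dimensional $G$-representation $V$ and a $G$-embedding $h \colon X \to V$ such that $h(X)$ is a $G$-retract of some $G$-invariant open subset of $V$. A $G$-space $X$ is a $G$-ANR if $X$ is metrizable and for each $G$-homeomorphism $h$ of $X$ onto a closed $G$-subset $h(X)$ of a metrizable $G$-space $Y$, $h(X)$ is a $G$-neighborhood retract of $Y$. ENR and ANR are the cases of trivial $G$. The map $p$ is symmetrically locally equiconnected (symmetrically LEC) if $\Delta_E \colon E \to E \times_B E$ is a closed $\mathbb{Z}_2$-equivariant cofibration, where $\mathbb{Z}_2$ acts trivially on $E$ and by transposition on $E \times_B E$. Here the inclusion $L \hookrightarrow K$ of a closed $G$-subspace is a $G$-cofibration if every $G$-map $(K \times \{0\}) \cup (L \times I) \to Y$ to any $G$-space $Y$ extends to a continuous $G$-map $K \times I \to Y$, with $G$ acting trivially on $I=[0,1]$ and diagonally on $K \times I$. *)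

theory Defs
  imports "HOL-Analysis.Analysis" "HOL-Algebra.Elementary_Groups"
begin

text \<open>
  Group actions on topological spaces are considered for finite groups with the discrete topology.
  These are compact Lie groups, and for them continuity of the action map
  \<open>G \<times> X \<rightarrow> X\<close> means that every group element acts continuously.
\<close>

definition G_space ::
  "('g, 'm) monoid_scheme \<Rightarrow> 'x topology \<Rightarrow> ('g \<Rightarrow> 'x \<Rightarrow> 'x) \<Rightarrow> bool" where
  "G_space G X a \<longleftrightarrow>
     group G \<and> finite (carrier G) \<and>
     (\<forall>g\<in>carrier G. continuous_map X X (a g)) \<and>
     (\<forall>x\<in>topspace X. a \<one>\<^bsub>G\<^esub> x = x) \<and>
     (\<forall>g\<in>carrier G. \<forall>h\<in>carrier G. \<forall>x\<in>topspace X. a (g \<otimes>\<^bsub>G\<^esub> h) x = a g (a h x))"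

definition G_map ::
  "('g, 'm) monoid_scheme \<Rightarrow> 'x topology \<Rightarrow> ('g \<Rightarrow> 'x \<Rightarrow> 'x) \<Rightarrow>
   'y topology \<Rightarrow> ('g \<Rightarrow> 'y \<Rightarrow> 'y) \<Rightarrow> ('x \<Rightarrow> 'y) \<Rightarrow> bool" where
  "G_map G X a Y c f \<longleftrightarrow>
     continuous_map X Y f \<and>
     (\<forall>g\<in>carrier G. \<forall>x\<in>topspace X. f (a g x) = c g (f x))"

definition G_invariant ::
  "('g, 'm) monoid_scheme \<Rightarrow> ('g \<Rightarrow> 'x \<Rightarrow> 'x) \<Rightarrow> 'x set \<Rightarrow> bool" where
  "G_invariant G a S \<longleftrightarrow> (\<forall>g\<in>carrier G. \<forall>x\<in>S. a g x \<in> S)"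

definition G_retract ::
  "('g, 'm) monoid_scheme \<Rightarrow> 'x topology \<Rightarrow> ('g \<Rightarrow> 'x \<Rightarrow> 'x) \<Rightarrow> 'x set \<Rightarrow> bool" where
  "G_retract G X a S \<longleftrightarrow>
     S \<subseteq> topspace X \<and> G_invariant G a S \<and>
     (\<exists>r. G_map G X a (subtopology X S) a r \<and> (\<forall>x\<in>S. r x = x))"

definition G_neighborhood_retract ::
  "('g, 'm) monoid_scheme \<Rightarrow> 'x topology \<Rightarrow> ('g \<Rightarrow> 'x \<Rightarrow> 'x) \<Rightarrow> 'x set \<Rightarrow> bool" where
  "G_neighborhood_retract G X a S \<longleftrightarrow>
     (\<exists>U. openin X U \<and> G_invariant G a U \<and> G_retract G (subtopology X U) a S)"

text \<open>
  Up to the choice of a basis, a finite-dimensional real representation is a linear action on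
  \<^const>\<open>Euclidean_space\<close> \<open>n\<close>, the copy of \<open>n\<close>-dimensional real space consisting of the sequences
  that vanish from index \<open>n\<close> on.  As \<open>n\<close> is a term, it can be quantified existentially.
\<close>

definition G_representation ::
  "('g, 'm) monoid_scheme \<Rightarrow> nat \<Rightarrow> ('g \<Rightarrow> (nat \<Rightarrow> real) \<Rightarrow> (nat \<Rightarrow> real)) \<Rightarrow> bool" where
  "G_representation G n \<rho> \<longleftrightarrow>
     G_space G (Euclidean_space n) \<rho> \<and>
     (\<forall>g\<in>carrier G. \<forall>x\<in>topspace (Euclidean_space n). \<forall>y\<in>topspace (Euclidean_space n). \<forall>s t.
        \<rho> g (\<lambda>i. s * x i + t * y i) = (\<lambda>i. s * \<rho> g x i + t * \<rho> g y i))"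

definition G_ENR ::
  "('g, 'm) monoid_scheme \<Rightarrow> 'x topology \<Rightarrow> ('g \<Rightarrow> 'x \<Rightarrow> 'x) \<Rightarrow> bool" where
  "G_ENR G X a \<longleftrightarrow>
     G_space G X a \<and>
     (\<exists>n \<rho> h. G_representation G n \<rho> \<and>
        embedding_map X (Euclidean_space n) h \<and> G_map G X a (Euclidean_space n) \<rho> h \<and>
        G_neighborhood_retract G (Euclidean_space n) \<rho> (h ` topspace X))"

text \<open>
  HOL cannot quantify over all metrizable spaces \<open>Y\<close> of arbitrary type inside a definition.  It is
  enough to let \<open>Y\<close> range over the topologies on sets of functions \<open>'x \<Rightarrow> real\<close>: after choosing an
  invariant bounded metric on \<open>X\<close>, the Kuratowski--Wojdyslawski embedding \<open>x \<mapsto> d(x, -)\<close> is a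
  \<open>G\<close>-homeomorphism of \<open>X\<close> onto a closed subset of its convex hull in the bounded functions on \<open>X\<close>.
  If \<open>X\<close> is a \<open>G\<close>-neighborhood retract of that convex hull, then Dugundji's extension theorem,
  followed by averaging over the finite group \<open>G\<close>, shows the same for every closed equivariant
  embedding of \<open>X\<close> into a metrizable \<open>G\<close>-space of any type.
\<close>

definition G_ANR ::
  "('g, 'm) monoid_scheme \<Rightarrow> 'x topology \<Rightarrow> ('g \<Rightarrow> 'x \<Rightarrow> 'x) \<Rightarrow> bool" where
  "G_ANR G X a \<longleftrightarrow>
     G_space G X a \<and> metrizable_space X \<and>
     (\<forall>(Y :: ('x \<Rightarrow> real) topology) c h.
        metrizable_space Y \<and> G_space G Y c \<and>
        embedding_map X Y h \<and> G_map G X a Y c h \<and> closedin Y (h ` topspace X) \<longrightarrow>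
        G_neighborhood_retract G Y c (h ` topspace X))"

text \<open>
  The constants \<open>ENR\<close> and \<open>ANR\<close> of \<open>HOL-Analysis\<close> apply only to subsets of a topological space
  given by a type class, and the latter tests a set only against sets of pairs of an element of
  the same type and a real number, which is adequate for subsets of Euclidean spaces.
\<close>

definition ENR_space :: "'x topology \<Rightarrow> bool" where
  "ENR_space X \<longleftrightarrow> G_ENR (singleton_group ()) X (\<lambda>g x. x)"

definition ANR_space :: "'x topology \<Rightarrow> bool" where
  "ANR_space X \<longleftrightarrow> G_ANR (singleton_group ()) X (\<lambda>g x. x)"

text \<open>
  The homotopy extension property is tested on target spaces of the type \<open>'y\<close> given by the first
  argument.  The unrestricted notion is expressed by stating it with a free type variable \<open>'y\<close>.
\<close>

definition closed_G_cofibration_inclusion ::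
  "'y itself \<Rightarrow> ('g, 'm) monoid_scheme \<Rightarrow> 'x topology \<Rightarrow> ('g \<Rightarrow> 'x \<Rightarrow> 'x) \<Rightarrow> 'x set \<Rightarrow> bool" where
  "closed_G_cofibration_inclusion _ G K a L \<longleftrightarrow>
     G_space G K a \<and> closedin K L \<and> G_invariant G a L \<and>
     (let KI = prod_topology K (top_of_set {0..1::real});
          aI = (\<lambda>g (x, t). (a g x, t))
      in \<forall>(Y :: 'y topology) c f.
           G_space G Y c \<and>
           G_map G (subtopology KI (topspace K \<times> {0} \<union> L \<times> {0..1})) aI Y c f \<longrightarrow>
           (\<exists>F. G_map G KI aI Y c F \<and>
                (\<forall>z \<in> topspace K \<times> {0} \<union> L \<times> {0..1}. F z = f z)))"

definition closed_G_cofibration ::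
  "'y itself \<Rightarrow> ('g, 'm) monoid_scheme \<Rightarrow> 'w topology \<Rightarrow> ('g \<Rightarrow> 'w \<Rightarrow> 'w) \<Rightarrow>
   'x topology \<Rightarrow> ('g \<Rightarrow> 'x \<Rightarrow> 'x) \<Rightarrow> ('w \<Rightarrow> 'x) \<Rightarrow> bool" where
  "closed_G_cofibration T G A \<alpha> K a i \<longleftrightarrow>
     G_space G A \<alpha> \<and> G_map G A \<alpha> K a i \<and> embedding_map A K i \<and>
     closed_G_cofibration_inclusion T G K a (i ` topspace A)"

text \<open>
  The fibre \<open>F\<close> may depend on the point of the base and may be empty.  Taking its type to be that
  of \<open>E\<close> is no restriction, since \<open>F\<close> is homeomorphic to the subspace \<open>p -` {b}\<close> of \<open>E\<close>.
\<close>

definition locally_trivial_fibration ::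
  "'e topology \<Rightarrow> 'b topology \<Rightarrow> ('e \<Rightarrow> 'b) \<Rightarrow> bool" where
  "locally_trivial_fibration E B p \<longleftrightarrow>
     continuous_map E B p \<and>
     (\<forall>b\<in>topspace B. \<exists>U (F :: 'e topology) \<phi>.
        openin B U \<and> b \<in> U \<and>
        homeomorphic_map (subtopology E {e \<in> topspace E. p e \<in> U})
                         (prod_topology (subtopology B U) F) \<phi> \<and>
        (\<forall>e\<in>topspace E. p e \<in> U \<longrightarrow> fst (\<phi> e) = p e))"

definition fibre_square :: "'e topology \<Rightarrow> ('e \<Rightarrow> 'b) \<Rightarrow> ('e \<times> 'e) topology" where
  "fibre_square E p = subtopology (prod_topology E E) {(e1, e2). p e1 = p e2}"

definition Z2 :: "int monoid" where
  "Z2 = integer_mod_group 2"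

definition transposition_action :: "int \<Rightarrow> 'e \<times> 'e \<Rightarrow> 'e \<times> 'e" where
  "transposition_action g = (if g = 0 then id else prod.swap)"

definition symmetrically_LEC :: "'y itself \<Rightarrow> 'e topology \<Rightarrow> ('e \<Rightarrow> 'b) \<Rightarrow> bool" where
  "symmetrically_LEC T E p \<longleftrightarrow>
     closed_G_cofibration T Z2 E (\<lambda>g e. e)
       (fibre_square E p) transposition_action (\<lambda>e. (e, e))"

end

theory Submission
  imports Defs
begin

text \<open>
  An equivariant map from a space with involution \<open>\<sigma>\<close> into \<open>E \<times>\<^sub>B E\<close> is the same as a map
  \<open>f\<close> into \<open>E\<close> with \<open>p \<circ> f \<circ> \<sigma> = p \<circ> f\<close>.  For open \<open>V \<subseteq> B\<close>, consider the property that every such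
  \<open>f\<close> with values over \<open>V\<close>, given on a closed invariant subset of a metric space, extends to an
  invariant neighbourhood.  If \<open>p\<close> is trivial over \<open>V\<close>, this holds because \<open>E\<close> is an ENR: the coordinate in
  the fibre is extended arbitrarily, and the coordinate in \<open>V\<close>, which is a retract of
  \<open>V \<times> F\<close>, is extended after averaging over \<open>\<sigma>\<close>.  As in Hanner's theorem for ANRs, the property
  passes to unions of two open sets and to disjoint unions of open sets, hence by an argument of
  Michael to countable unions, and so to all of \<open>B\<close>.  Applied to a neighbourhood of \<open>E \<times>\<^sub>B E\<close> in
  \<open>\<real>\<^sup>n \<times> \<real>\<^sup>n\<close> with the swap, it yields the equivariant neighbourhood retraction.  A countable trivializing cover of the image of \<open>p\<close> exists because \<open>E\<close> is Lindeloef.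

  Retracting the segments from \<open>(x, y)\<close> to its midpoint on the diagonal gives an equivariant
  deformation of a neighbourhood of the diagonal into the diagonal, which makes the diagonal an equivariant
  NDR and therefore its inclusion a cofibration.
\<close>

subsection \<open>Extension of fibrewise symmetric maps\<close>

text \<open>Only the first coordinate of an equivariant map into the fibre square is kept; the
  second is \<open>f \<circ> \<sigma>\<close>. The set \<open>V\<close> localizes the notion over
  the base.\<close>

definition fibrewise_symmetric ::
  "('a::topological_space \<Rightarrow> 'a) \<Rightarrow> 'e topology \<Rightarrow> ('e \<Rightarrow> 'b) \<Rightarrow> 'b set \<Rightarrow> 'a set \<Rightarrow> ('a \<Rightarrow> 'e) \<Rightarrow> bool" where
  "fibrewise_symmetric \<sigma> E p V S f \<longleftrightarrow>
     \<sigma> ` S \<subseteq> S \<and> continuous_map (top_of_set S) E f \<and>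
     (\<forall>y\<in>S. p (f y) \<in> V \<and> p (f (\<sigma> y)) = p (f y))"

text \<open>The domain \<open>Y\<close> is quantified so that an extension can be built in stages,
  over invariant pieces of a larger domain.\<close>

definition fibrewise_extendable ::
  "('a::topological_space \<Rightarrow> 'a) \<Rightarrow> 'e topology \<Rightarrow> ('e \<Rightarrow> 'b) \<Rightarrow> 'b set \<Rightarrow> bool" where
  "fibrewise_extendable \<sigma> E p V \<longleftrightarrow>
     (\<forall>Y A f. \<sigma> ` Y \<subseteq> Y \<and> closedin (top_of_set Y) A \<and> fibrewise_symmetric \<sigma> E p V A f \<longrightarrow>
        (\<exists>U g. openin (top_of_set Y) U \<and> A \<subseteq> U \<and> fibrewise_symmetric \<sigma> E p V U g \<and>
               (\<forall>a\<in>A. g a = f a)))"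

lemma fibrewise_extendableE:
  assumes "fibrewise_extendable \<sigma> E p V" "\<sigma> ` Y \<subseteq> Y" "closedin (top_of_set Y) A"
    "fibrewise_symmetric \<sigma> E p V A f"
  obtains U g where "openin (top_of_set Y) U" "A \<subseteq> U" "fibrewise_symmetric \<sigma> E p V U g"
    "\<And>a. a \<in> A \<Longrightarrow> g a = f a"
  using assms(1)[unfolded fibrewise_extendable_def, rule_format, of Y A f] assms(2-4) that by auto

lemma fibrewise_symmetric_subset:
  assumes "fibrewise_symmetric \<sigma> E p V S f" "T \<subseteq> S" "\<sigma> ` T \<subseteq> T" "\<And>y. y \<in> T \<Longrightarrow> p (f y) \<in> W"
  shows "fibrewise_symmetric \<sigma> E p W T f"
  using assms unfolding fibrewise_symmetric_def
  by (auto intro: continuous_map_from_subtopology_mono)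

lemma fibrewise_symmetric_mono:
  "fibrewise_symmetric \<sigma> E p V S f \<Longrightarrow> V \<subseteq> W \<Longrightarrow> fibrewise_symmetric \<sigma> E p W S f"
  unfolding fibrewise_symmetric_def by auto

text \<open>Each piece is \<open>\<sigma>\<close>-invariant, so \<open>x\<close> and
  \<open>\<sigma> x\<close> lie in a common piece and the condition on \<open>p\<close> is inherited
  from it; agreement on the overlap makes the choice of formula harmless.\<close>

lemma fibrewise_symmetric_Un_closed:
  assumes S: "closedin (top_of_set (S \<union> T)) S" and T: "closedin (top_of_set (S \<union> T)) T"
    and f: "fibrewise_symmetric \<sigma> E p V S f" and g: "fibrewise_symmetric \<sigma> E p V T g"
    and eq: "\<And>x. x \<in> S \<Longrightarrow> x \<in> T \<Longrightarrow> f x = g x"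
  shows "fibrewise_symmetric \<sigma> E p V (S \<union> T) (\<lambda>x. if x \<in> S then f x else g x)"
proof -
  have "continuous_map (top_of_set (S \<union> T)) E (\<lambda>x. if x \<in> S then f x else g x)"
  proof (rule pasting_lemma_closed[where I = "UNIV::bool set"
        and T = "\<lambda>b. if b then S else T" and f = "\<lambda>b. if b then f else g"])
    show "continuous_map (subtopology (top_of_set (S \<union> T)) (if i then S else T)) E (if i then f else g)"
      for i
      using f g by (auto simp: fibrewise_symmetric_def subtopology_subtopology Int_absorb1)
  qed (use S T eq in \<open>auto split: if_splits\<close>)
  with f g eq show ?thesis
    unfolding fibrewise_symmetric_def by (auto simp: image_subset_iff)
qed

lemma fibrewise_symmetric_UN_disjoint:
  fixes U :: "nat \<Rightarrow> 'a::topological_space set"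
  assumes U: "\<And>k. openin (top_of_set Y) (U k)" and disj: "disjoint_family U"
    and g: "\<And>k. fibrewise_symmetric \<sigma> E p V (U k) (g k)"
  obtains G where "fibrewise_symmetric \<sigma> E p V (\<Union>k. U k) G" "\<And>k x. x \<in> U k \<Longrightarrow> G x = g k x"
proof -
  have sub: "U k \<subseteq> Y" for k using U openin_imp_subset by blast
  define G where "G x = g (SOME k. x \<in> U k) x" for x
  have G: "G x = g k x" if "x \<in> U k" for x k
  proof -
    have "x \<in> U (SOME k. x \<in> U k)" using that by (rule someI)
    then have "(SOME k. x \<in> U k) = k" using disj that by (auto simp: disjoint_family_on_def)
    then show ?thesis by (simp add: G_def)
  qed
  have "continuous_map (top_of_set (\<Union>k. U k)) E G"
  proof (rule pasting_lemma[where I = UNIV and T = U and f = g])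
    show "openin (top_of_set (\<Union>k. U k)) (U i)" for i
      by (rule openin_subset_trans[OF U]) (use sub in auto)
    show "continuous_map (subtopology (top_of_set (\<Union>k. U k)) (U i)) E (g i)" for i
      using g[of i] by (simp add: fibrewise_symmetric_def subtopology_subtopology Int_absorb1 UN_upper)
    show "g i x = g j x" if "x \<in> topspace (top_of_set (\<Union>k. U k)) \<inter> U i \<inter> U j" for i j x
      using G[of x i] G[of x j] that by auto
  qed (use G in auto)
  moreover have "p (G y) \<in> V \<and> p (G (\<sigma> y)) = p (G y)" "\<sigma> y \<in> (\<Union>k. U k)" if "y \<in> U k" for k y
    using g[of k] that G[of y k] G[of "\<sigma> y" k] by (auto simp: fibrewise_symmetric_def)
  ultimately have "fibrewise_symmetric \<sigma> E p V (\<Union>k. U k) G"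
    unfolding fibrewise_symmetric_def by blast
  with G that show thesis by blast
qed

text \<open>An extension with values over \<open>V\<close> is restricted to the open set where its
  values lie over \<open>W\<close>. That set is invariant because \<open>p \<circ> g\<close> takes
  the same value at \<open>y\<close> and at \<open>\<sigma> y\<close>.\<close>

lemma fibrewise_extendable_open_subset:
  assumes p: "continuous_map E B p" and V: "fibrewise_extendable \<sigma> E p V"
    and W: "openin B W" "W \<subseteq> V"
  shows "fibrewise_extendable \<sigma> E p W"
  unfolding fibrewise_extendable_def
proof clarify
  fix Y A f assume Y: "\<sigma> ` Y \<subseteq> Y" and A: "closedin (top_of_set Y) A"
    and f: "fibrewise_symmetric \<sigma> E p W A f"
  obtain U g where U: "openin (top_of_set Y) U" "A \<subseteq> U" and g: "fibrewise_symmetric \<sigma> E p V U g"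
    and gf: "\<And>a. a \<in> A \<Longrightarrow> g a = f a"
    using fibrewise_extendableE[OF V Y A fibrewise_symmetric_mono[OF f W(2)]] by blast
  define N where "N = {y \<in> U. p (g y) \<in> W}"
  have "openin (top_of_set U) {y \<in> topspace (top_of_set U). (p \<circ> g) y \<in> W}"
    using g p W(1) unfolding fibrewise_symmetric_def
    by (intro openin_continuous_map_preimage) (auto simp del: o_apply intro: continuous_map_compose)
  then have "openin (top_of_set Y) N"
    using U(1) openin_trans by (fastforce simp: N_def)
  moreover have "A \<subseteq> N" using U(2) f gf by (auto simp: N_def fibrewise_symmetric_def)
  moreover have "fibrewise_symmetric \<sigma> E p W N g"
    by (rule fibrewise_symmetric_subset[OF g]) (use g in \<open>auto simp: N_def fibrewise_symmetric_def\<close>)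
  ultimately show "\<exists>U g. openin (top_of_set Y) U \<and> A \<subseteq> U \<and> fibrewise_symmetric \<sigma> E p W U g \<and> (\<forall>a\<in>A. g a = f a)"
    using gf by blast
qed

section \<open>Gluing extensions over unions of open sets\<close>

lemma invariant_open_neighbourhood:
  assumes \<sigma>: "continuous_on Y \<sigma>" "\<sigma> ` Y \<subseteq> Y" "\<And>x. \<sigma> (\<sigma> x) = x"
    and N: "openin (top_of_set Y) N" and A: "A \<subseteq> N" "\<sigma> ` A \<subseteq> A"
  obtains N' where "openin (top_of_set Y) N'" "A \<subseteq> N'" "N' \<subseteq> N" "\<sigma> ` N' \<subseteq> N'"
proof
  \<comment> \<open>One preimage is enough: as \<open>\<sigma>\<close> is an involution, the
    intersection of \<open>N\<close> with its preimage is already invariant.\<close>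
  have "openin (top_of_set Y) (Y \<inter> \<sigma> -` N)"
    using continuous_openin_preimage[OF \<sigma>(1) _ N] \<sigma>(2) by auto
  then show "openin (top_of_set Y) (N \<inter> (Y \<inter> \<sigma> -` N))"
    using N by blast
  show "A \<subseteq> N \<inter> (Y \<inter> \<sigma> -` N)" using A N openin_imp_subset by blast
  show "\<sigma> ` (N \<inter> (Y \<inter> \<sigma> -` N)) \<subseteq> N \<inter> (Y \<inter> \<sigma> -` N)"
    using \<sigma>(2,3) by auto
qed auto

text \<open>The neighbourhoods are cut from the points closer to \<open>A k\<close> than to the
  union of the other sets; by \<open>rest\<close>, this union is at positive distance from each
  point of \<open>A k\<close>. The metric need not be invariant under \<open>\<sigma>\<close>, so
  invariance is restored afterwards by shrinking.\<close>

lemma disjoint_invariant_neighbourhoods: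
  fixes A :: "nat \<Rightarrow> 'a::metric_space set"
  assumes \<sigma>: "continuous_on Y \<sigma>" "\<sigma> ` Y \<subseteq> Y" "\<And>x. \<sigma> (\<sigma> x) = x"
    and A: "\<And>k. closedin (top_of_set Y) (A k)" "\<And>k. \<sigma> ` A k \<subseteq> A k"
    and rest: "\<And>k. closedin (top_of_set Y) (\<Union>j\<in>-{k}. A j)" and disj: "disjoint_family A"
  obtains N where "\<And>k. openin (top_of_set Y) (N k)" "\<And>k. A k \<subseteq> N k" "\<And>k. \<sigma> ` N k \<subseteq> N k"
    "disjoint_family N"
proof -
  define R where "R k = (\<Union>j\<in>-{k}. A j)" for k
  \<comment> \<open>By convention \<open>infdist\<close> to the empty set is 0, so the cases with an
    empty set are split off.\<close>
  define M where "M k = (if A k = {} then {} else if R k = {} then Y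
    else {y \<in> Y. infdist y (A k) < infdist y (R k)})" for k
  have opM: "openin (top_of_set Y) (M k)" for k
  proof -
    have "openin (top_of_set Y) (Y \<inter> (\<lambda>y. infdist y (R k) - infdist y (A k)) -` {0<..})"
      by (intro continuous_openin_preimage_gen continuous_intros)
    moreover have "Y \<inter> (\<lambda>y. infdist y (R k) - infdist y (A k)) -` {0<..} = {y \<in> Y. infdist y (A k) < infdist y (R k)}"
      by auto
    ultimately show ?thesis by (auto simp: M_def)
  qed
  have AM: "A k \<subseteq> M k" for k
  proof
    fix a assume a: "a \<in> A k"
    then have aY: "a \<in> Y" using A(1) closedin_imp_subset by blast
    have "infdist a (R k) > 0" if "R k \<noteq> {}"
    proof -
      have "a \<notin> R k" using a disj by (auto simp: R_def disjoint_family_on_def)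
      \<comment> \<open>\<open>R k\<close> is closed only relative to \<open>Y\<close>; positivity
        of the distance is taken from a closed set of the whole space that cuts it out.\<close>
      moreover obtain C where C: "closed C" "R k = Y \<inter> C" using rest[of k] by (auto simp: closedin_closed R_def)
      ultimately have "a \<notin> C" using aY by auto
      then have "infdist a C > 0" using C that by (intro infdist_pos_not_in_closed) auto
      moreover have "infdist a C \<le> infdist a (R k)" using C that by (intro infdist_mono) auto
      ultimately show ?thesis by linarith
    qed
    moreover have "infdist a (A k) = 0" using a by simp
    ultimately show "a \<in> M k" using a aY by (auto simp: M_def)
  qed
  have disjM: "M k \<inter> M j = {}" if "k \<noteq> j" for k j
  proof -
    have False if y: "y \<in> M k" "y \<in> M j" for y
    proof -
      have ne: "A k \<noteq> {}" "A j \<noteq> {}" using y by (auto simp: M_def split: if_splits)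
      have s: "A j \<subseteq> R k" "A k \<subseteq> R j" using \<open>k \<noteq> j\<close> by (auto simp: R_def)
      then have "infdist y (A k) < infdist y (R k)" "infdist y (A j) < infdist y (R j)"
        using ne y by (auto simp: M_def split: if_splits)
      moreover have "infdist y (R k) \<le> infdist y (A j)" "infdist y (R j) \<le> infdist y (A k)"
        using s ne by (auto intro: infdist_mono)
      ultimately show False by linarith
    qed
    then show ?thesis by blast
  qed
  have "\<exists>N'. openin (top_of_set Y) N' \<and> A k \<subseteq> N' \<and> N' \<subseteq> M k \<and> \<sigma> ` N' \<subseteq> N'" for k
    using invariant_open_neighbourhood[OF \<sigma> opM AM A(2)] by metis
  then obtain N where N: "\<And>k. openin (top_of_set Y) (N k) \<and> A k \<subseteq> N k \<and> N k \<subseteq> M k \<and> \<sigma> ` N k \<subseteq> N k"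
    by metis
  have "disjoint_family N"
    using N disjM unfolding disjoint_family_on_def by blast
  with N that show thesis by blast
qed

text \<open>The disjoint sets \<open>V k\<close> split \<open>A\<close> into relatively open and
  closed invariant pieces \<open>D k\<close>. Each piece is extended inside its own neighbourhood,
  and since these are disjoint, the extensions glue without any compatibility condition.\<close>

lemma fibrewise_extendable_UN_disjoint:
  fixes \<sigma> :: "'a::metric_space \<Rightarrow> 'a" and V :: "nat \<Rightarrow> 'b set"
  assumes \<sigma>: "continuous_on UNIV \<sigma>" "\<And>x. \<sigma> (\<sigma> x) = x" and p: "continuous_map E B p"
    and V: "\<And>k. openin B (V k)" "\<And>k. fibrewise_extendable \<sigma> E p (V k)" and disj: "disjoint_family V"
  shows "fibrewise_extendable \<sigma> E p (\<Union>k. V k)"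
  unfolding fibrewise_extendable_def
proof clarify
  fix Y A f assume Y: "\<sigma> ` Y \<subseteq> Y" and A: "closedin (top_of_set Y) A"
    and f: "fibrewise_symmetric \<sigma> E p (\<Union>k. V k) A f"
  define D where "D k = {a \<in> A. p (f a) \<in> V k}" for k
  have op: "openin (top_of_set A) {a \<in> A. p (f a) \<in> W}" if "openin B W" for W
    using openin_continuous_map_preimage[of "top_of_set A" B "p \<circ> f" W] f p that
    by (auto simp: fibrewise_symmetric_def intro: continuous_map_compose)
  have rest: "(\<Union>j\<in>-{k}. D j) = A - D k" for k
    using f disj by (auto simp: D_def fibrewise_symmetric_def disjoint_family_on_def)
  have clD: "closedin (top_of_set A) (D k)" for k
  proof -
    have "openin (top_of_set A) (\<Union>j\<in>-{k}. D j)"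
      unfolding D_def using op V(1) by blast
    moreover have "A - (\<Union>j\<in>-{k}. D j) = D k" unfolding rest by (auto simp: D_def)
    ultimately show ?thesis
      by (metis closedin_diff closedin_topspace topspace_euclidean_subtopology)
  qed
  have "closedin (top_of_set A) (A - D k)" for k
    using op[OF V(1)[of k]] by (simp add: D_def closedin_diff)
  then have clR: "closedin (top_of_set Y) (\<Union>j\<in>-{k}. D j)" for k
    unfolding rest using A closedin_trans by blast
  have clDY: "closedin (top_of_set Y) (D k)" for k using clD A closedin_trans by blast
  have invD: "\<sigma> ` D k \<subseteq> D k" for k using f by (auto simp: D_def fibrewise_symmetric_def)
  have disjD: "disjoint_family D" using disj by (auto simp: D_def disjoint_family_on_def)
  obtain N where N: "\<And>k. openin (top_of_set Y) (N k)" "\<And>k. D k \<subseteq> N k" "\<And>k. \<sigma> ` N k \<subseteq> N k"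
    "disjoint_family N"
    using disjoint_invariant_neighbourhoods[OF continuous_on_subset[OF \<sigma>(1)] Y \<sigma>(2) clDY invD clR disjD] by blast
  have "\<exists>U g. openin (top_of_set (N k)) U \<and> D k \<subseteq> U \<and> fibrewise_symmetric \<sigma> E p (V k) U g \<and>
        (\<forall>a\<in>D k. g a = f a)" for k
  proof (rule fibrewise_extendableE[OF V(2) N(3)])
    show "closedin (top_of_set (N k)) (D k)"
      by (rule closedin_subset_trans[OF clDY]) (use N openin_imp_subset[OF N(1)] in auto)
    show "fibrewise_symmetric \<sigma> E p (V k) (D k) f"
      by (rule fibrewise_symmetric_subset[OF f]) (use invD in \<open>auto simp: D_def\<close>)
  qed blast
  then obtain U g where U: "\<And>k. openin (top_of_set (N k)) (U k)" "\<And>k. D k \<subseteq> U k"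
    and g: "\<And>k. fibrewise_symmetric \<sigma> E p (V k) (U k) (g k)" and gf: "\<And>k a. a \<in> D k \<Longrightarrow> g k a = f a"
    by metis
  have UY: "openin (top_of_set Y) (U k)" for k using U(1) N(1) openin_trans by blast
  have disjU: "disjoint_family U"
    using N(4) U(1)[THEN openin_imp_subset] unfolding disjoint_family_on_def by blast
  obtain G where G: "fibrewise_symmetric \<sigma> E p (\<Union>k. V k) (\<Union>k. U k) G" "\<And>k x. x \<in> U k \<Longrightarrow> G x = g k x"
    using fibrewise_symmetric_UN_disjoint[OF UY disjU fibrewise_symmetric_mono[OF g]] by (metis UNIV_I UN_upper)
  have A_D: "\<exists>k. a \<in> D k" if "a \<in> A" for a using f that by (auto simp: D_def fibrewise_symmetric_def)
  have "openin (top_of_set Y) (\<Union>k. U k)" using UY by blast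
  moreover have "A \<subseteq> (\<Union>k. U k)" using A_D U(2) by blast
  moreover have "\<forall>a\<in>A. G a = f a" using A_D U(2) G(2) gf by (metis subsetD)
  ultimately show "\<exists>U g. openin (top_of_set Y) U \<and> A \<subseteq> U \<and> fibrewise_symmetric \<sigma> E p (\<Union>k. V k) U g \<and> (\<forall>a\<in>A. g a = f a)"
    using G(1) by blast
qed

text \<open>Hanner's argument. The parts \<open>A1\<close> and \<open>A2\<close> of \<open>A\<close>
  lying over the complements of \<open>V2\<close> and \<open>V1\<close> are separated by disjoint
  invariant open sets \<open>Y1\<close> and \<open>Y2\<close>. On the closed remainder
  \<open>Y0\<close> the map has values over \<open>V1 \<inter> V2\<close> and is extended first.
  That extension is then continued into \<open>Y1\<close> over \<open>V1\<close> and into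
  \<open>Y2\<close> over \<open>V2\<close>, and the two continuations agree where they meet.\<close>

lemma fibrewise_extendable_Un:
  fixes \<sigma> :: "'a::metric_space \<Rightarrow> 'a"
  assumes \<sigma>: "continuous_on UNIV \<sigma>" "\<And>x. \<sigma> (\<sigma> x) = x" and p: "continuous_map E B p"
    and V1: "openin B V1" "fibrewise_extendable \<sigma> E p V1"
    and V2: "openin B V2" "fibrewise_extendable \<sigma> E p V2"
  shows "fibrewise_extendable \<sigma> E p (V1 \<union> V2)"
  unfolding fibrewise_extendable_def
proof clarify
  fix Y A f assume Y: "\<sigma> ` Y \<subseteq> Y" and A: "closedin (top_of_set Y) A"
    and f: "fibrewise_symmetric \<sigma> E p (V1 \<union> V2) A f"
  have AY: "A \<subseteq> Y" using A closedin_imp_subset by blast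
  have invA: "\<sigma> ` A \<subseteq> A" using f by (simp add: fibrewise_symmetric_def)
  have cl: "closedin (top_of_set Y) {a \<in> A. p (f a) \<notin> W}" if "openin B W" for W
  proof -
    have "openin (top_of_set A) {a \<in> topspace (top_of_set A). (p \<circ> f) a \<in> W}"
      using f p that unfolding fibrewise_symmetric_def
      by (intro openin_continuous_map_preimage) (auto simp del: o_apply intro: continuous_map_compose)
    then have "closedin (top_of_set A) (A - {a \<in> A. p (f a) \<in> W})"
      by (simp add: closedin_diff)
    moreover have "A - {a \<in> A. p (f a) \<in> W} = {a \<in> A. p (f a) \<notin> W}" by auto
    ultimately show ?thesis using A closedin_trans by metis
  qed
  define A1 where "A1 = {a \<in> A. p (f a) \<notin> V2}"
  define A2 where "A2 = {a \<in> A. p (f a) \<notin> V1}"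
  \<comment> \<open>The two sets are padded with empty ones to form a sequence, so that the
    separation of countable families applies.\<close>
  define D where "D k = (if k = 0 then A1 else if k = 1 then A2 else {})" for k :: nat
  have D: "closedin (top_of_set Y) (D k)" "\<sigma> ` D k \<subseteq> D k" for k
    using cl V1 V2 f by (auto simp: D_def A1_def A2_def fibrewise_symmetric_def)
  have rest: "(\<Union>j\<in>-{k}. D j) = (if k = 0 then A2 else if k = 1 then A1 else A1 \<union> A2)" for k
    by (auto simp: D_def split: if_splits)
  have clR: "closedin (top_of_set Y) (\<Union>j\<in>-{k}. D j)" for k
    using D(1)[of 0] D(1)[of 1] unfolding rest by (auto simp: D_def)
  have disjD: "disjoint_family D"
    using f by (auto simp: D_def A1_def A2_def disjoint_family_on_def fibrewise_symmetric_def)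
  obtain N where N: "\<And>k. openin (top_of_set Y) (N k)" "\<And>k. D k \<subseteq> N k"
    "\<And>k. \<sigma> ` N k \<subseteq> N k" "disjoint_family N"
    using disjoint_invariant_neighbourhoods[OF continuous_on_subset[OF \<sigma>(1)] Y \<sigma>(2) D clR disjD] by blast
  define Y1 where "Y1 = N 0"
  define Y2 where "Y2 = N 1"
  have Y12: "openin (top_of_set Y) Y1" "openin (top_of_set Y) Y2" "\<sigma> ` Y1 \<subseteq> Y1" "\<sigma> ` Y2 \<subseteq> Y2"
    "A1 \<subseteq> Y1" "A2 \<subseteq> Y2" "Y1 \<inter> Y2 = {}"
    using N(1,3) N(2)[of 0] N(2)[of 1] N(4) by (auto simp: Y1_def Y2_def D_def disjoint_family_on_def)
  have Y12sub: "Y1 \<subseteq> Y" "Y2 \<subseteq> Y"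
    using openin_imp_subset[OF Y12(1)] openin_imp_subset[OF Y12(2)] by auto
  have inv_diff: "\<sigma> ` (S - T) \<subseteq> S - T" if "\<sigma> ` S \<subseteq> S" "\<sigma> ` T \<subseteq> T" for S T
  proof clarify
    fix x assume "x \<in> S" "x \<notin> T"
    then have "\<sigma> x \<in> S" using that(1) by auto
    moreover have "\<sigma> x \<notin> T"
    proof
      assume "\<sigma> x \<in> T"
      then have "\<sigma> (\<sigma> x) \<in> T" using that(2) by auto
      with \<open>x \<notin> T\<close> show False by (simp add: \<sigma>(2))
    qed
    ultimately show "\<sigma> x \<in> S - T" by blast
  qed
  define Y0 where "Y0 = Y - (Y1 \<union> Y2)"
  have clY0: "closedin (top_of_set Y) Y0"
    using Y12 by (auto simp: Y0_def intro: closedin_diff)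
  have invY0: "\<sigma> ` Y0 \<subseteq> Y0" unfolding Y0_def using Y Y12 by (intro inv_diff) auto
  \<comment> \<open>Extend first over the part of \<open>A\<close> away from \<open>A1\<close> and \<open>A2\<close>, which maps into the overlap.\<close>
  have V12: "fibrewise_extendable \<sigma> E p (V1 \<inter> V2)"
    by (rule fibrewise_extendable_open_subset[OF p V1(2)]) (use V1 V2 in auto)
  have clAY0: "closedin (top_of_set Y0) (A \<inter> Y0)"
    by (rule closedin_subset_trans[OF closedin_Int[OF A clY0]]) (auto simp: Y0_def)
  have fAY0: "fibrewise_symmetric \<sigma> E p (V1 \<inter> V2) (A \<inter> Y0) f"
  proof (rule fibrewise_symmetric_subset[OF f])
    show "\<sigma> ` (A \<inter> Y0) \<subseteq> A \<inter> Y0" using invY0 invA by blast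
    show "p (f y) \<in> V1 \<inter> V2" if "y \<in> A \<inter> Y0" for y
    proof -
      have "y \<notin> A1" "y \<notin> A2" using that Y12(5,6) by (auto simp: Y0_def)
      with that show ?thesis by (auto simp: A1_def A2_def)
    qed
  qed auto
  obtain U0 g0 where U0: "openin (top_of_set Y0) U0" "A \<inter> Y0 \<subseteq> U0"
    and g0: "fibrewise_symmetric \<sigma> E p (V1 \<inter> V2) U0 g0" and g0f: "\<And>a. a \<in> A \<inter> Y0 \<Longrightarrow> g0 a = f a"
    using fibrewise_extendableE[OF V12 invY0 clAY0 fAY0] by blast
  have invU0: "\<sigma> ` U0 \<subseteq> U0" using g0 by (simp add: fibrewise_symmetric_def)
  have U0Y0: "U0 \<subseteq> Y0" by (rule openin_imp_subset[OF U0(1)])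
  \<comment> \<open>The points of \<open>Y0\<close> not reached by the first extension are
    discarded. The rest \<open>Z\<close> is open in \<open>Y\<close>, and inside it
    \<open>U0\<close>, \<open>U0 \<union> Y1\<close> and \<open>U0 \<union> Y2\<close> are
    closed.\<close>
  define Z where "Z = Y - (Y0 - U0)"
  have ZY: "Z \<subseteq> Y" by (auto simp: Z_def)
  have "closedin (top_of_set Y0) (Y0 - U0)" using U0 by (simp add: closedin_diff)
  then have "closedin (top_of_set Y) (Y0 - U0)" using clY0 by (rule closedin_trans)
  then have opZ: "openin (top_of_set Y) Z"
    unfolding Z_def by (intro openin_diff openin_subtopology_self)
  have AZ: "A \<subseteq> Z" using AY U0 by (auto simp: Z_def)
  have Zdecomp: "Z = U0 \<union> (Y1 \<union> Y2)" using U0Y0 Y12sub by (auto simp: Z_def Y0_def)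
  have disj0: "U0 \<inter> (Y1 \<union> Y2) = {}" using U0Y0 by (auto simp: Y0_def)
  have opZi: "openin (top_of_set Z) Y1" "openin (top_of_set Z) Y2"
    by (rule openin_subset_trans[OF Y12(1) _ ZY] openin_subset_trans[OF Y12(2) _ ZY], use Zdecomp in blast)+
  have clA: "closedin (top_of_set Z) A" using A AZ ZY by (rule closedin_subset_trans)
  \<comment> \<open>Stated for an abstract side \<open>Y'\<close> with opposite side
    \<open>Y''\<close>, to be used once for \<open>Y1\<close> over \<open>V1\<close> and once for
    \<open>Y2\<close> over \<open>V2\<close>.\<close>
  have side: "\<exists>U g. openin (top_of_set (U0 \<union> Y')) U \<and> (A \<inter> Y') \<union> U0 \<subseteq> U \<and>
      fibrewise_symmetric \<sigma> E p (V1 \<union> V2) U g \<and> (\<forall>a\<in>A \<inter> Y'. g a = f a) \<and> (\<forall>a\<in>U0. g a = g0 a)"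
    if W: "fibrewise_extendable \<sigma> E p W" "V1 \<inter> V2 \<subseteq> W" "W \<subseteq> V1 \<union> V2"
      and AW: "\<And>a. a \<in> A \<Longrightarrow> a \<notin> Y'' \<Longrightarrow> p (f a) \<in> W"
      and Y': "Z = U0 \<union> (Y' \<union> Y'')" "Y' \<inter> Y'' = {}" "U0 \<inter> (Y' \<union> Y'') = {}" "\<sigma> ` Y' \<subseteq> Y'"
      "openin (top_of_set Z) Y'" "openin (top_of_set Z) Y''" for W Y' Y''
  proof -
    let ?S = "A \<inter> (U0 \<union> Y')"
    have clU0Y': "closedin (top_of_set Z) (U0 \<union> Y')"
    proof -
      have "U0 \<union> Y' = Z - Y''" using Y' by auto
      then show ?thesis using Y'(6) by (simp add: closedin_diff)
    qed
    have clU0: "closedin (top_of_set Z) U0"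
    proof -
      have "U0 = Z - (Y' \<union> Y'')" using Y' by auto
      then show ?thesis using Y'(5,6) by (simp add: closedin_diff openin_Un)
    qed
    have clS: "closedin (top_of_set Z) ?S" using clA clU0Y' by blast
    have inZ: "?S \<union> U0 \<subseteq> Z" using Y' by auto
    have f': "fibrewise_symmetric \<sigma> E p W ?S f"
    proof (rule fibrewise_symmetric_subset[OF f])
      show "\<sigma> ` ?S \<subseteq> ?S" using invA invU0 Y'(4) by auto
      show "p (f y) \<in> W" if "y \<in> ?S" for y using AW[of y] that Y'(2,3) by auto
    qed auto
    have "fibrewise_symmetric \<sigma> E p W (?S \<union> U0) (\<lambda>x. if x \<in> ?S then f x else g0 x)"
    proof (rule fibrewise_symmetric_Un_closed)
      show "closedin (top_of_set (?S \<union> U0)) ?S" "closedin (top_of_set (?S \<union> U0)) U0"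
        by (rule closedin_subset_trans[OF clS] closedin_subset_trans[OF clU0], use inZ in auto)+
      show "fibrewise_symmetric \<sigma> E p W U0 g0" by (rule fibrewise_symmetric_mono[OF g0 W(2)])
      show "f x = g0 x" if "x \<in> ?S" "x \<in> U0" for x using g0f[of x] that U0Y0 by auto
    qed (rule f')
    note ext = this
    have clSU: "closedin (top_of_set (U0 \<union> Y')) (?S \<union> U0)"
      by (rule closedin_subset_trans[OF closedin_Un[OF clS clU0]]) (use Y'(1) in auto)
    have invUY: "\<sigma> ` (U0 \<union> Y') \<subseteq> U0 \<union> Y'" using invU0 Y'(4) by auto
    obtain U g where U: "openin (top_of_set (U0 \<union> Y')) U" "?S \<union> U0 \<subseteq> U"
      and g: "fibrewise_symmetric \<sigma> E p W U g"
      and gf: "\<And>a. a \<in> ?S \<union> U0 \<Longrightarrow> g a = (if a \<in> ?S then f a else g0 a)"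
      using fibrewise_extendableE[OF W(1) invUY clSU ext] by blast
    have "g a = g0 a" if "a \<in> U0" for a using gf[of a] g0f[of a] that U0Y0 by auto
    moreover have "g a = f a" if "a \<in> A \<inter> Y'" for a using gf[of a] that by auto
    moreover have "A \<inter> Y' \<union> U0 \<subseteq> U" using U(2) by auto
    ultimately show ?thesis using U(1) fibrewise_symmetric_mono[OF g W(3)] by blast
  qed
  have s1: "p (f a) \<in> V1" if "a \<in> A" "a \<notin> Y2" for a using that Y12 by (auto simp: A2_def)
  have s2: "p (f a) \<in> V2" if "a \<in> A" "a \<notin> Y1" for a using that Y12 by (auto simp: A1_def)
  obtain U1 g1 where U1: "openin (top_of_set (U0 \<union> Y1)) U1" "(A \<inter> Y1) \<union> U0 \<subseteq> U1"
      and g1: "fibrewise_symmetric \<sigma> E p (V1 \<union> V2) U1 g1"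
      and g1f: "\<forall>a\<in>A \<inter> Y1. g1 a = f a" "\<forall>a\<in>U0. g1 a = g0 a"
    using side[OF V1(2) Int_lower1 Un_upper1 s1 Zdecomp Y12(7) disj0 Y12(3) opZi] by blast
  have Zdecomp': "Z = U0 \<union> (Y2 \<union> Y1)" and disj': "Y2 \<inter> Y1 = {}" "U0 \<inter> (Y2 \<union> Y1) = {}"
    using Zdecomp disj0 Y12(7) by auto
  obtain U2 g2 where U2: "openin (top_of_set (U0 \<union> Y2)) U2" "(A \<inter> Y2) \<union> U0 \<subseteq> U2"
      and g2: "fibrewise_symmetric \<sigma> E p (V1 \<union> V2) U2 g2"
      and g2f: "\<forall>a\<in>A \<inter> Y2. g2 a = f a" "\<forall>a\<in>U0. g2 a = g0 a"
    using side[OF V2(2) Int_lower2 Un_upper2 s2 Zdecomp' disj' Y12(4) opZi(2,1)] by blast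
  have sub: "U1 \<subseteq> U0 \<union> Y1" "U2 \<subseteq> U0 \<union> Y2"
    using openin_imp_subset[OF U1(1)] openin_imp_subset[OF U2(1)] by auto
  have cl1: "closedin (top_of_set Z) (U0 \<union> Y1)" and cl2: "closedin (top_of_set Z) (U0 \<union> Y2)"
  proof -
    have "U0 \<union> Y1 = Z - Y2" "U0 \<union> Y2 = Z - Y1" using Zdecomp disj0 Y12(7) by auto
    then show "closedin (top_of_set Z) (U0 \<union> Y1)" "closedin (top_of_set Z) (U0 \<union> Y2)"
      using opZi by (simp_all add: closedin_diff)
  qed
  \<comment> \<open>\<open>U1\<close> and \<open>U2\<close> are open only in the closed halves of
    \<open>Z\<close>. Since both contain \<open>U0\<close>, the complement of their union in
    \<open>Z\<close> is the union of the complements in the halves, hence closed.\<close>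
  have "U1 \<union> U2 = Z - ((U0 \<union> Y1 - U1) \<union> (U0 \<union> Y2 - U2))"
    using Zdecomp disj0 Y12(7) U1(2) U2(2) sub by auto
  moreover have "closedin (top_of_set Z) (U0 \<union> Y1 - U1)" "closedin (top_of_set Z) (U0 \<union> Y2 - U2)"
    by (rule closedin_trans[OF _ cl1] closedin_trans[OF _ cl2], use U1(1) U2(1) in \<open>simp add: closedin_diff\<close>)+
  ultimately have "openin (top_of_set Z) (U1 \<union> U2)" by (simp add: closedin_Un openin_diff)
  then have opU: "openin (top_of_set Y) (U1 \<union> U2)" using opZ by (rule openin_trans)
  have UZ: "U1 \<union> U2 \<subseteq> Z" using sub Zdecomp by auto
  have U1eq: "(U1 \<union> U2) \<inter> (U0 \<union> Y1) = U1" "(U1 \<union> U2) \<inter> (U0 \<union> Y2) = U2"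
    using sub disj0 Y12(7) U1(2) U2(2) by auto
  have "closedin (top_of_set (U1 \<union> U2)) ((U1 \<union> U2) \<inter> C)" if clC: "closedin (top_of_set Z) C" for C
  proof -
    obtain T where "closed T" "C = Z \<inter> T" using clC by (auto simp: closedin_closed)
    moreover from this have "(U1 \<union> U2) \<inter> C = (U1 \<union> U2) \<inter> T" using UZ by blast
    ultimately show ?thesis by (simp add: closedin_closed_Int)
  qed
  from this[OF cl1] this[OF cl2]
  have clU: "closedin (top_of_set (U1 \<union> U2)) U1" "closedin (top_of_set (U1 \<union> U2)) U2"
    by (simp_all only: U1eq)
  have agree: "g1 x = g2 x" if "x \<in> U1" "x \<in> U2" for x
  proof -
    have "x \<in> U0" using that sub Y12(7) by blast
    then show ?thesis using g1f(2) g2f(2) by simp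
  qed
  have g: "fibrewise_symmetric \<sigma> E p (V1 \<union> V2) (U1 \<union> U2) (\<lambda>x. if x \<in> U1 then g1 x else g2 x)"
    by (rule fibrewise_symmetric_Un_closed[OF clU g1 g2 agree])
  have ga: "(if a \<in> U1 then g1 a else g2 a) = f a" "a \<in> U1 \<union> U2" if a: "a \<in> A" for a
  proof -
    consider "a \<in> U0" | "a \<in> Y1" | "a \<in> Y2" using a AZ Zdecomp by auto
    then have "(if a \<in> U1 then g1 a else g2 a) = f a \<and> a \<in> U1 \<union> U2"
    proof cases
      case 1 then show ?thesis using U1(2) g1f(2) g0f[of a] a U0Y0 by auto
    next
      case 2 then show ?thesis using U1(2) g1f(1) a by auto
    next
      case 3 then have "a \<notin> U1" using sub Y12(7) disj0 by blast
      with 3 show ?thesis using U2(2) g2f(1) a by auto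
    qed
    then show "(if a \<in> U1 then g1 a else g2 a) = f a" "a \<in> U1 \<union> U2" by auto
  qed
  show "\<exists>U g. openin (top_of_set Y) U \<and> A \<subseteq> U \<and> fibrewise_symmetric \<sigma> E p (V1 \<union> V2) U g \<and> (\<forall>a\<in>A. g a = f a)"
    using opU g ga by (intro exI[of _ "U1 \<union> U2"] exI[of _ "\<lambda>x. if x \<in> U1 then g1 x else g2 x"]) blast
qed

text \<open>This is Michael's principle for local properties. The finite unions \<open>U n\<close>
  increase to the whole union, which is divided into open shells, each inside some
  \<open>U n\<close>. Shells of even index are pairwise disjoint, as are those of odd index, so two
  disjoint unions and one binary union suffice.\<close>

lemma metrizable_local_property:
  fixes B :: "'b topology" and V :: "nat \<Rightarrow> 'b set"
  assumes B: "metrizable_space B"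
    and open_subset: "\<And>V W. Q V \<Longrightarrow> openin B W \<Longrightarrow> W \<subseteq> V \<Longrightarrow> Q W"
    and Un: "\<And>V W. openin B V \<Longrightarrow> openin B W \<Longrightarrow> Q V \<Longrightarrow> Q W \<Longrightarrow> Q (V \<union> W)"
    and disjoint: "\<And>V. (\<And>k::nat. openin B (V k)) \<Longrightarrow> (\<And>k. Q (V k)) \<Longrightarrow> disjoint_family V \<Longrightarrow> Q (\<Union>k. V k)"
    and V: "\<And>k. openin B (V k)" "\<And>k. Q (V k)"
  shows "Q (\<Union>k. V k)"
proof -
  obtain M d where "Metric_space M d" and Beq: "B = Metric_space.mtopology M d"
    using B by (auto simp: metrizable_space_def)
  then interpret Metric_space M d by simp
  define U where "U n = (\<Union>k\<le>n. V k)" for n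
  have opU: "openin B (U n)" for n unfolding U_def using V(1) by blast
  have QU: "Q (U n)" for n
  proof (induction n)
    case 0 then show ?case using V(2)[of 0] by (simp add: U_def)
  next
    case (Suc n)
    have "U (Suc n) = U n \<union> V (Suc n)" by (auto simp: U_def atMost_Suc)
    then show ?case using Un[OF opU V(1) Suc V(2)] by simp
  qed
  have U_mono: "m \<le> n \<Longrightarrow> U m \<subseteq> U n" for m n unfolding U_def by (rule UN_mono) auto
  have UM: "U n \<subseteq> M" for n using openin_subset[OF opU[of n]] by (simp add: Beq)
  \<comment> \<open>An exhaustion by closed sets; the open shells around \<open>C (Suc n) - C n\<close> with \<open>n\<close> of a fixed parity
    are pairwise disjoint.\<close>
  define C where "C n = (if n = 0 then {} else {b \<in> M. mball b (1 / real n) \<subseteq> U n})" for n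
  have C_U: "C n \<subseteq> U n" for n by (force simp: C_def split: if_splits)
  \<comment> \<open>The difference of the radii is just what the triangle inequality needs to fit a
    ball of radius \<open>1 / real (Suc n)\<close> around \<open>y\<close> into the larger ball
    around \<open>b\<close>.\<close>
  have C_step: "mball b (1 / real n - 1 / real (Suc n)) \<subseteq> C (Suc n)" if "b \<in> C n" for n b
  proof
    fix y assume y: "y \<in> mball b (1 / real n - 1 / real (Suc n))"
    have "n \<noteq> 0" and bM: "b \<in> M" and b: "mball b (1 / real n) \<subseteq> U n" using that by (auto simp: C_def split: if_splits)
    have "mball y (1 / real (Suc n)) \<subseteq> mball b (1 / real n)"
      using y bM by (intro mball_subset) (auto simp: commute)
    then show "y \<in> C (Suc n)" using b U_mono[of n "Suc n"] y by (auto simp: C_def)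
  qed
  have C_mono: "C n \<subseteq> C (Suc n)" for n
  proof
    fix b assume b: "b \<in> C n"
    then have "n \<noteq> 0" "b \<in> M" by (auto simp: C_def split: if_splits)
    then have "b \<in> mball b (1 / real n - 1 / real (Suc n))" by (simp add: frac_less2)
    then show "b \<in> C (Suc n)" using C_step[OF b] by blast
  qed
  then have C_mono': "m \<le> n \<Longrightarrow> C m \<subseteq> C n" for m n by (rule lift_Suc_mono_le)
  have C_int: "C n \<subseteq> B interior_of (C (Suc n))" for n
  proof
    fix b assume b: "b \<in> C n"
    then have n: "n \<noteq> 0" "b \<in> M" by (auto simp: C_def split: if_splits)
    show "b \<in> B interior_of (C (Suc n))"
    proof (rule subsetD[OF interior_of_maximal[OF C_step[OF b]]])
      show "openin B (mball b (1 / real n - 1 / real (Suc n)))" by (simp add: Beq)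
      show "b \<in> mball b (1 / real n - 1 / real (Suc n))" using n by (simp add: frac_less2)
    qed
  qed
  have C_closed: "closedin B (C n)" for n
  proof (cases "n = 0")
    case False
    have "\<exists>r>0. disjnt (C n) (mball b r)" if b: "b \<in> M - C n" for b
    proof -
      have "\<not> mball b (1 / real n) \<subseteq> U n" using b False by (simp add: C_def)
      then obtain x where x: "x \<in> mball b (1 / real n)" "x \<notin> U n" by blast
      \<comment> \<open>The point \<open>x\<close> outside \<open>U n\<close> stays within distance
        \<open>1 / real n\<close> of every point closer to \<open>b\<close> than \<open>r\<close>,
        so no such point is in \<open>C n\<close>.\<close>
      define r where "r = 1 / real n - d b x"
      have "r > 0" using x by (simp add: r_def)
      moreover have "disjnt (C n) (mball b r)"
      proof -
        have "x \<in> mball c (1 / real n)" if c: "c \<in> mball b r" for c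
        proof -
          have "d c x \<le> d c b + d b x" using c x by (intro triangle) auto
          then show ?thesis using c x by (simp add: r_def commute)
        qed
        moreover have "mball c (1 / real n) \<subseteq> U n" if "c \<in> C n" for c
          using that False by (simp add: C_def)
        ultimately show ?thesis using x(2) unfolding disjnt_iff by blast
      qed
      ultimately show ?thesis by blast
    qed
    moreover have "C n \<subseteq> M" by (auto simp: C_def)
    ultimately show ?thesis unfolding Beq closedin_metric by blast
  qed (simp add: C_def)
  define W where "W n = B interior_of (C (Suc (Suc n))) - C n" for n
  have opW: "openin B (W n)" for n unfolding W_def using C_closed by (intro openin_diff) auto
  have W_U: "W n \<subseteq> U (Suc (Suc n))" for n
    using interior_of_subset[of B "C (Suc (Suc n))"] C_U[of "Suc (Suc n)"] by (auto simp: W_def)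
  have QW: "Q (W n)" for n by (rule open_subset[OF QU opW W_U])
  have disjW: "W m \<inter> W n = {}" if "Suc m < n" for m n
  proof -
    have "W m \<subseteq> C n" using interior_of_subset[of B "C (Suc (Suc m))"] C_mono'[of "Suc (Suc m)" n] that
      by (auto simp: W_def)
    then show ?thesis by (auto simp: W_def)
  qed
  have disj: "disjoint_family (\<lambda>k. W (2 * k + i))" for i
    unfolding disjoint_family_on_def
  proof clarify
    fix k l :: nat assume "k \<noteq> l"
    then consider "Suc (2 * k + i) < 2 * l + i" | "Suc (2 * l + i) < 2 * k + i" by linarith
    then show "W (2 * k + i) \<inter> W (2 * l + i) = {}"
      using disjW[of "2 * k + i" "2 * l + i"] disjW[of "2 * l + i" "2 * k + i"] by cases auto
  qed
  have Qi: "Q (\<Union>k. W (2 * k + i))" for i by (rule disjoint[OF opW QW disj])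
  have "(\<Union>k. V k) = (\<Union>k. W (2 * k + 0)) \<union> (\<Union>k. W (2 * k + 1))"
  proof
    show "(\<Union>k. W (2 * k + 0)) \<union> (\<Union>k. W (2 * k + 1)) \<subseteq> (\<Union>k. V k)"
      using W_U unfolding U_def by blast
    show "(\<Union>k. V k) \<subseteq> (\<Union>k. W (2 * k + 0)) \<union> (\<Union>k. W (2 * k + 1))"
    proof
      fix b assume "b \<in> (\<Union>k. V k)"
      then obtain k where k: "b \<in> V k" by blast
      then obtain r where r: "r > 0" "mball b r \<subseteq> V k" using V(1)[of k] by (auto simp: Beq openin_mtopology)
      obtain n where n: "n > 0" "1 / real n < r" using r(1) by (metis nat_approx_posE zero_less_Suc)
      have bM: "b \<in> M" using k UM[of k] by (auto simp: U_def)
      \<comment> \<open>The index \<open>n + k\<close> serves both ends: the radius stays below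
        \<open>r\<close>, and \<open>U (n + k)\<close> contains \<open>V k\<close>.\<close>
      have "mball b (1 / real (n + k)) \<subseteq> mball b r"
        using n by (intro mball_subset_concentric) (smt (verit) frac_le of_nat_0_less_iff of_nat_mono le_add1)
      also have "\<dots> \<subseteq> U (n + k)"
      proof -
        have "V k \<subseteq> U (n + k)" unfolding U_def by (rule UN_upper) simp
        with r(2) show ?thesis by blast
      qed
      finally have "b \<in> C (n + k)" using n bM by (simp add: C_def)
      then have ex: "\<exists>m. b \<in> C m" by blast
      \<comment> \<open>The predecessor \<open>j\<close> of the first index with \<open>b\<close> in
        \<open>C m\<close> names the shell of \<open>b\<close>: \<open>b\<close> is outside
        \<open>C j\<close> and interior to \<open>C (Suc (Suc j))\<close>.\<close>
      define m where "m = (LEAST m. b \<in> C m)"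
      have m: "b \<in> C m" unfolding m_def using ex by (rule LeastI_ex)
      have "C 0 = {}" by (simp add: C_def)
      then have "m \<noteq> 0" using m by (metis empty_iff)
      then obtain j where j: "m = Suc j" by (cases m) auto
      have "b \<notin> C j" using not_less_Least[of j "\<lambda>m. b \<in> C m"] j by (simp add: m_def)
      moreover have "b \<in> B interior_of (C (Suc (Suc j)))" using C_int m j by blast
      ultimately have bW: "b \<in> W j" by (simp add: W_def)
      have "j = 2 * (j div 2) + 0 \<or> j = 2 * (j div 2) + 1" by presburger
      then show "b \<in> (\<Union>k. W (2 * k + 0)) \<union> (\<Union>k. W (2 * k + 1))"
        using bW by (metis UN_I UNIV_I UnI1 UnI2)
    qed
  qed
  moreover have opWi: "openin B (\<Union>k. W (2 * k + i))" for i
    by (rule openin_Union) (use opW in auto)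
  ultimately show ?thesis using Un[OF opWi opWi Qi Qi, of 0 1] by simp
qed

subsection \<open>Fibrations of ENRs\<close>

lemma Euclidean_space_eq: "Euclidean_space n = top_of_set {x. \<forall>i\<ge>n. x i = 0}"
  by (simp add: Euclidean_space_def euclidean_product_topology)

text \<open>The data of an ENR with the image of the embedding eliminated: \<open>r\<close> is the
  neighbourhood retraction followed by the inverse of \<open>h\<close>, so it lands in
  \<open>E\<close> itself.\<close>

locale neighbourhood_retract =
  fixes E :: "'e topology" and n :: nat and \<Omega> :: "(nat \<Rightarrow> real) set"
    and h :: "'e \<Rightarrow> nat \<Rightarrow> real" and r :: "(nat \<Rightarrow> real) \<Rightarrow> 'e"
  assumes open_\<Omega>: "openin (Euclidean_space n) \<Omega>"
    and h: "continuous_map E (top_of_set \<Omega>) h"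
    and r: "continuous_map (top_of_set \<Omega>) E r"
    and r_h: "e \<in> topspace E \<Longrightarrow> r (h e) = e"
begin

lemma \<Omega>_zero: "x \<in> \<Omega> \<Longrightarrow> i \<ge> n \<Longrightarrow> x i = 0"
  using openin_subset[OF open_\<Omega>] by (auto simp: topspace_Euclidean_space)

lemma h_in: "e \<in> topspace E \<Longrightarrow> h e \<in> \<Omega>"
  using continuous_map_image_subset_topspace[OF h] by auto

lemma continuous_map_h_component:
  assumes "continuous_map X E f"
  shows "continuous_map X euclideanreal (\<lambda>x. h (f x) i)"
proof -
  have "continuous_map (top_of_set \<Omega>) euclideanreal (\<lambda>x. x i)"
    using continuous_on_subset[OF continuous_on_product_coordinates] by auto
  from continuous_map_compose[OF continuous_map_compose[OF assms h] this]
  show ?thesis by (simp add: o_def)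
qed

text \<open>The coordinates of \<open>h \<circ> f\<close> extend by Tietze's theorem. Averaging over
  \<open>y\<close> and \<open>\<sigma> y\<close> makes the extension invariant and leaves it
  unchanged on \<open>A\<close>, where \<open>f\<close> is invariant; \<open>r\<close> is applied
  where the average lies in \<open>\<Omega>\<close>.\<close>

lemma extend_invariant:
  fixes f :: "'a::{metric_space,second_countable_topology} \<Rightarrow> 'e"
  assumes \<sigma>: "continuous_on Y \<sigma>" "\<sigma> ` Y \<subseteq> Y" "\<And>x. \<sigma> (\<sigma> x) = x"
    and A: "closedin (top_of_set Y) A" "\<sigma> ` A \<subseteq> A"
    and f: "continuous_map (top_of_set A) E f" "\<And>a. a \<in> A \<Longrightarrow> f (\<sigma> a) = f a"
  obtains U g where "openin (top_of_set Y) U" "A \<subseteq> U" "\<sigma> ` U \<subseteq> U"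
    "continuous_map (top_of_set U) E g" "\<And>y. y \<in> U \<Longrightarrow> g (\<sigma> y) = g y" "\<And>a. a \<in> A \<Longrightarrow> g a = f a"
proof -
  have AY: "A \<subseteq> Y" using A(1) by (rule closedin_imp_subset)
  have fE: "f a \<in> topspace E" if "a \<in> A" for a
    using continuous_map_image_subset_topspace[OF f(1)] that by auto
  have "continuous_on A (\<lambda>a. h (f a) i)" for i
    using continuous_map_h_component[OF f(1)] by simp
  then have "\<exists>F. continuous_on Y F \<and> (\<forall>a\<in>A. F a = h (f a) i)" for i
    using Tietze_unbounded[of A "\<lambda>a. h (f a) i" Y] A(1) by metis
  then obtain F where F: "\<And>i. continuous_on Y (F i)" "\<And>i a. a \<in> A \<Longrightarrow> F i a = h (f a) i"
    by metis
  \<comment> \<open>Coordinates from \<open>n\<close> on are set to 0 so that \<open>G\<close> takes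
    values in \<open>Euclidean_space n\<close>, where \<open>\<Omega>\<close> is open.\<close>
  define G where "G y i = (if i < n then (F i y + F i (\<sigma> y)) / 2 else 0)" for y i
  have "continuous_on Y (\<lambda>y. F i (\<sigma> y))" for i
    by (rule continuous_on_compose2[OF F(1) \<sigma>(1,2)])
  then have "continuous_on Y (\<lambda>y. G y i)" for i
    using F(1) by (cases "i < n") (auto simp: G_def intro!: continuous_intros)
  then have G: "continuous_on Y G" by (rule continuous_on_coordinatewise_then_product)
  have G\<sigma>: "G (\<sigma> y) = G y" for y by (simp add: G_def \<sigma>(3) add.commute fun_eq_iff)
  have GA: "G a = h (f a)" if a: "a \<in> A" for a
  proof
    fix i
    have "\<sigma> a \<in> A" using a A(2) by blast
    then show "G a i = h (f a) i"
      using a F(2) f(2) h_in[OF fE] \<Omega>_zero by (auto simp: G_def)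
  qed
  define U where "U = Y \<inter> G -` \<Omega>"
  have "openin (top_of_set Y) U"
    unfolding U_def
    by (rule continuous_openin_preimage[OF G _ open_\<Omega>[unfolded Euclidean_space_eq]]) (auto simp: G_def)
  moreover have "A \<subseteq> U" using AY GA fE h_in by (auto simp: U_def)
  moreover have "\<sigma> ` U \<subseteq> U" using \<sigma>(2) G\<sigma> by (auto simp: U_def)
  moreover have "continuous_map (top_of_set U) E (\<lambda>y. r (G y))"
  proof -
    have "continuous_map (top_of_set U) (top_of_set \<Omega>) G"
      using continuous_on_subset[OF G] by (auto simp: continuous_map_in_subtopology U_def)
    from continuous_map_compose[OF this r] show ?thesis by (simp add: o_def)
  qed
  moreover have "r (G (\<sigma> y)) = r (G y)" for y by (simp add: G\<sigma>)
  moreover have "r (G a) = f a" if "a \<in> A" for a using GA r_h fE that by simp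
  ultimately show thesis by (rule that)
qed

text \<open>In the product \<open>V \<times> F\<close> the symmetry condition concerns only the
  first coordinate. Both coordinates are extended through maps into \<open>E\<close>, so extension
  properties are needed of the ENR \<open>E\<close> alone and not of \<open>V\<close> or
  \<open>F\<close>.\<close>

lemma fibrewise_extendable_trivial:
  fixes \<sigma> :: "'a::{metric_space,second_countable_topology} \<Rightarrow> 'a"
  assumes \<sigma>: "continuous_on UNIV \<sigma>" "\<And>x. \<sigma> (\<sigma> x) = x"
    and p: "continuous_map E B p" and V: "openin B V"
    and \<phi>: "homeomorphic_map (subtopology E {e \<in> topspace E. p e \<in> V}) (prod_topology (subtopology B V) F) \<phi>"
    and fst_\<phi>: "\<And>e. e \<in> topspace E \<Longrightarrow> p e \<in> V \<Longrightarrow> fst (\<phi> e) = p e"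
  shows "fibrewise_extendable \<sigma> E p V"
  unfolding fibrewise_extendable_def
proof clarify
  fix Y :: "'a set" and A f assume Y: "\<sigma> ` Y \<subseteq> Y" and A: "closedin (top_of_set Y) A"
    and f: "fibrewise_symmetric \<sigma> E p V A f"
  show "\<exists>U g. openin (top_of_set Y) U \<and> A \<subseteq> U \<and> fibrewise_symmetric \<sigma> E p V U g \<and> (\<forall>a\<in>A. g a = f a)"
  \<comment> \<open>The fibre \<open>F\<close> may be empty; a point \<open>x0\<close> in it is
    obtained from a point of \<open>A\<close>.\<close>
  proof (cases "A = {}")
    case True
    then show ?thesis using f by (intro exI[of _ "{}"] exI[of _ f]) auto
  next
    case False
    define EV where "EV = subtopology E {e \<in> topspace E. p e \<in> V}"
    have topEV: "topspace EV = {e \<in> topspace E. p e \<in> V}" by (auto simp: EV_def)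
    obtain \<psi> where "homeomorphic_maps EV (prod_topology (subtopology B V) F) \<phi> \<psi>"
      using \<phi> unfolding homeomorphic_map_maps EV_def by blast
    then have cont: "continuous_map EV (prod_topology (subtopology B V) F) \<phi>"
        "continuous_map (prod_topology (subtopology B V) F) EV \<psi>"
      and inv: "\<And>e. e \<in> topspace EV \<Longrightarrow> \<psi> (\<phi> e) = e"
        "\<And>z. z \<in> topspace (prod_topology (subtopology B V) F) \<Longrightarrow> \<phi> (\<psi> z) = z"
      unfolding homeomorphic_maps_def by auto
    have VB: "V \<subseteq> topspace B" using V by (rule openin_subset)
    have \<psi>E: "\<psi> (v, x) \<in> topspace E" "p (\<psi> (v, x)) = v" if "v \<in> V" "x \<in> topspace F" for v x
    proof -
      have vx: "(v, x) \<in> topspace (prod_topology (subtopology B V) F)" using that VB by auto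
      then have "\<psi> (v, x) \<in> topspace EV" using continuous_map_image_subset_topspace[OF cont(2)] by blast
      then show "\<psi> (v, x) \<in> topspace E" "p (\<psi> (v, x)) = v"
        using inv(2)[OF vx] fst_\<phi>[of "\<psi> (v, x)"] topEV by auto
    qed
    have sndF: "snd (\<phi> e) \<in> topspace F" if "e \<in> topspace E" "p e \<in> V" for e
    proof -
      have "\<phi> e \<in> topspace (prod_topology (subtopology B V) F)"
        using continuous_map_image_subset_topspace[OF cont(1)] topEV that by blast
      then show ?thesis by (auto simp: mem_Times_iff)
    qed
    have \<phi>_eq: "\<psi> (p e, snd (\<phi> e)) = e" if "e \<in> topspace E" "p e \<in> V" for e
      using inv(1)[of e] fst_\<phi>[OF that] that topEV by (metis (mono_tags, lifting) mem_Collect_eq prod.collapse)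
    have cf: "continuous_map (top_of_set A) E f" and invA: "\<sigma> ` A \<subseteq> A"
      and fV: "\<And>a. a \<in> A \<Longrightarrow> p (f a) \<in> V" "\<And>a. a \<in> A \<Longrightarrow> p (f (\<sigma> a)) = p (f a)"
      using f by (auto simp: fibrewise_symmetric_def)
    have fE: "f a \<in> topspace E" if "a \<in> A" for a
      using continuous_map_image_subset_topspace[OF cf] that by auto
    obtain a0 where a0: "a0 \<in> A" using False by blast
    define x0 where "x0 = snd (\<phi> (f a0))"
    have x0: "x0 \<in> topspace F" unfolding x0_def by (rule sndF[OF fE fV(1)]) (rule a0)+
    have open_preimage: "openin (top_of_set Y) {y \<in> U. p (k y) \<in> V}"
      if U: "openin (top_of_set Y) U" and k: "continuous_map (top_of_set U) E k" for U k
    proof -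
      have "openin (top_of_set U) {y \<in> topspace (top_of_set U). (p \<circ> k) y \<in> V}"
        using continuous_map_compose[OF k p] V by (rule openin_continuous_map_preimage)
      then show ?thesis using U openin_trans by (auto simp: o_def)
    qed
    \<comment> \<open>The \<open>F\<close>-coordinate is extended without regard to symmetry; the \<open>B\<close>-coordinate is
      pushed into \<open>E\<close> by the section \<open>v \<mapsto> \<psi> (v, x0)\<close> and extended symmetrically there.\<close>
    obtain U1 f1 where U1: "openin (top_of_set Y) U1" "A \<subseteq> U1"
      and f1: "continuous_map (top_of_set U1) E f1" "\<And>a. a \<in> A \<Longrightarrow> f1 a = f a"
    \<comment> \<open>With the identity as involution this is ordinary neighbourhood extension into
      an ENR.\<close>
    proof (rule extend_invariant[where \<sigma> = "\<lambda>y. y" and Y = Y and A = A and f = f])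
    qed (use A cf in auto)
    define N1 where "N1 = {y \<in> U1. p (f1 y) \<in> V}"
    have N1: "openin (top_of_set Y) N1" unfolding N1_def by (rule open_preimage[OF U1(1) f1(1)])
    have AN1: "A \<subseteq> N1" using U1(2) f1(2) fV(1) by (auto simp: N1_def)
    obtain N1' where N1': "openin (top_of_set Y) N1'" "A \<subseteq> N1'" "N1' \<subseteq> N1" "\<sigma> ` N1' \<subseteq> N1'"
      using invariant_open_neighbourhood[OF continuous_on_subset[OF \<sigma>(1)] Y \<sigma>(2) N1 AN1 invA] by blast
    let ?s = "\<lambda>a. \<psi> (p (f a), x0)"
    have "continuous_map (top_of_set A) (subtopology B V) (\<lambda>a. p (f a))"
      using continuous_map_compose[OF cf p] fV(1) by (auto simp: continuous_map_in_subtopology o_def)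
    then have "continuous_map (top_of_set A) (prod_topology (subtopology B V) F) (\<lambda>a. (p (f a), x0))"
      using x0 by (simp add: continuous_map_pairedI)
    then have cs: "continuous_map (top_of_set A) E ?s"
      using continuous_map_compose[OF _ cont(2)] continuous_map_into_fulltopology
      unfolding EV_def o_def by blast
    have s_inv: "?s (\<sigma> a) = ?s a" if "a \<in> A" for a using fV(2)[OF that] by simp
    obtain U2 b where U2: "openin (top_of_set Y) U2" "A \<subseteq> U2" "\<sigma> ` U2 \<subseteq> U2"
      and b: "continuous_map (top_of_set U2) E b" "\<And>y. y \<in> U2 \<Longrightarrow> b (\<sigma> y) = b y" "\<And>a. a \<in> A \<Longrightarrow> b a = ?s a"
      using extend_invariant[OF continuous_on_subset[OF \<sigma>(1)] Y \<sigma>(2) A invA cs s_inv] by blast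
    define U where "U = N1' \<inter> {y \<in> U2. p (b y) \<in> V}"
    \<comment> \<open>From \<open>b\<close> only its projection to the base is used, and from
      \<open>f1\<close> only the fibre coordinate. As \<open>b\<close> is invariant, so is
      \<open>p \<circ> g\<close>, although \<open>g\<close> itself need not be.\<close>
    define g where "g y = \<psi> (p (b y), snd (\<phi> (f1 y)))" for y
    have UY: "openin (top_of_set Y) U"
      unfolding U_def by (intro openin_Int N1'(1) open_preimage[OF U2(1) b(1)])
    have pb: "p (b a) = p (f a)" if "a \<in> A" for a using b(3)[OF that] \<psi>E(2)[OF fV(1)[OF that] x0] by simp
    have AU: "A \<subseteq> U" using N1'(2) U2(2) pb fV(1) by (auto simp: U_def)
    have invU: "\<sigma> ` U \<subseteq> U" using N1'(4) U2(3) b(2) by (auto simp: U_def image_subset_iff)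
    have U12: "U \<subseteq> U1" "U \<subseteq> U2" "U \<subseteq> N1" using N1'(3) by (auto simp: U_def N1_def)
    have bV: "p (b y) \<in> V" if "y \<in> U" for y using that by (simp add: U_def)
    have f1E: "f1 y \<in> topspace E" "p (f1 y) \<in> V" if "y \<in> U" for y
      using continuous_map_image_subset_topspace[OF f1(1)] that U12 by (auto simp: N1_def)
    have pg: "p (g y) = p (b y)" if "y \<in> U" for y
      unfolding g_def by (rule \<psi>E(2)[OF bV sndF]) (use that f1E in auto)
    have "continuous_map (top_of_set U) E g"
    proof -
      have cb: "continuous_map (top_of_set U) (subtopology B V) (\<lambda>y. p (b y))"
        using continuous_map_compose[OF continuous_map_from_subtopology_mono[OF b(1) U12(2)] p] bV
        by (auto simp: continuous_map_in_subtopology o_def)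
      have "continuous_map (top_of_set U) EV f1"
        using continuous_map_from_subtopology_mono[OF f1(1) U12(1)] f1E
        by (auto simp: EV_def continuous_map_in_subtopology)
      from continuous_map_compose[OF continuous_map_compose[OF this cont(1)] continuous_map_snd]
      have "continuous_map (top_of_set U) F (\<lambda>y. snd (\<phi> (f1 y)))" by (simp add: o_def)
      with cb have "continuous_map (top_of_set U) (prod_topology (subtopology B V) F) (\<lambda>y. (p (b y), snd (\<phi> (f1 y))))"
        by (rule continuous_map_pairedI)
      from continuous_map_compose[OF this cont(2)] show ?thesis
        unfolding EV_def o_def g_def by (rule continuous_map_into_fulltopology)
    qed
    moreover have "p (g y) \<in> V \<and> p (g (\<sigma> y)) = p (g y)" if "y \<in> U" for y
    proof -
      have "\<sigma> y \<in> U" using invU that by blast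
      then show ?thesis using pg bV b(2) U12(2) that by auto
    qed
    ultimately have "fibrewise_symmetric \<sigma> E p V U g"
      using invU by (auto simp: fibrewise_symmetric_def)
    moreover have "g a = f a" if "a \<in> A" for a
      unfolding g_def using pb f1(2) \<phi>_eq[OF fE fV(1)] that by simp
    ultimately show ?thesis using UY AU by blast
  qed
qed

end

section \<open>Extension over the whole base\<close>

context neighbourhood_retract
begin

text \<open>A trivializing cover is pulled back along \<open>p \<circ> r\<close> to
  \<open>\<Omega>\<close>, which is Lindeloef. The resulting countable subfamily covers the image of
  \<open>p\<close>; this is enough, since every map into \<open>E\<close> has its values over that
  image.\<close>

lemma fibrewise_extendable_topspace:
  fixes \<sigma> :: "'a::{metric_space,second_countable_topology} \<Rightarrow> 'a"
  assumes \<sigma>: "continuous_on UNIV \<sigma>" "\<And>x. \<sigma> (\<sigma> x) = x"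
    and p: "locally_trivial_fibration E B p" and B: "metrizable_space B"
  shows "fibrewise_extendable \<sigma> E p (topspace B)"
proof -
  have contp: "continuous_map E B p" using p by (simp add: locally_trivial_fibration_def)
  have pB: "p e \<in> topspace B" if "e \<in> topspace E" for e
    using continuous_map_image_subset_topspace[OF contp] that by auto
  have "\<exists>V. openin B V \<and> b \<in> V \<and> fibrewise_extendable \<sigma> E p V"
    if b: "b \<in> topspace B" for b
  proof -
    obtain V \<phi> and F :: "'e topology" where V: "openin B V" "b \<in> V"
      "homeomorphic_map (subtopology E {e \<in> topspace E. p e \<in> V}) (prod_topology (subtopology B V) F) \<phi>"
      "\<forall>e\<in>topspace E. p e \<in> V \<longrightarrow> fst (\<phi> e) = p e"
      using p b unfolding locally_trivial_fibration_def by blast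
    have "fibrewise_extendable \<sigma> E p V"
      by (rule fibrewise_extendable_trivial[OF \<sigma> contp V(1,3)]) (use V(4) in simp)
    with V(1,2) show ?thesis by blast
  qed
  then obtain V where V: "\<And>b. b \<in> topspace B \<Longrightarrow> openin B (V b)" "\<And>b. b \<in> topspace B \<Longrightarrow> b \<in> V b"
    "\<And>b. b \<in> topspace B \<Longrightarrow> fibrewise_extendable \<sigma> E p (V b)" by metis
  define N where "N b = {x \<in> \<Omega>. p (r x) \<in> V b}" for b
  have "openin (top_of_set \<Omega>) {x \<in> topspace (top_of_set \<Omega>). (p \<circ> r) x \<in> V b}" if "b \<in> topspace B" for b
    using continuous_map_compose[OF r contp] V(1)[OF that] by (rule openin_continuous_map_preimage)
  then have opN: "openin (top_of_set \<Omega>) S" if "S \<in> N ` topspace B" for S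
    using that by (auto simp: N_def)
  obtain \<F> where \<F>: "\<F> \<subseteq> N ` topspace B" "countable \<F>" "\<Union>\<F> = \<Union>(N ` topspace B)"
    using Lindelof_openin[OF opN] by blast
  obtain C where C: "countable C" "C \<subseteq> topspace B" "\<F> = N ` C"
    using \<F>(1,2) countable_subset_image[of \<F> N "topspace B"] by blast
  \<comment> \<open>For empty \<open>C\<close> the value of \<open>from_nat_into\<close> need not
    lie in \<open>topspace B\<close>, so the empty set is used instead.\<close>
  define W where "W k = (if C = {} then {} else V (from_nat_into C k))" for k
  have empty: "fibrewise_extendable \<sigma> E p {}"
    unfolding fibrewise_extendable_def
  proof clarify
    fix Y A f assume "fibrewise_symmetric \<sigma> E p {} A f"
    then show "\<exists>U g. openin (top_of_set Y) U \<and> A \<subseteq> U \<and> fibrewise_symmetric \<sigma> E p {} U g \<and> (\<forall>a\<in>A. g a = f a)"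
      by (intro exI[of _ A] exI[of _ f]) (auto simp: fibrewise_symmetric_def)
  qed
  have W: "openin B (W k)" "fibrewise_extendable \<sigma> E p (W k)" for k
    using V C(2) from_nat_into[of C k] empty by (auto simp: W_def)
  have ext: "fibrewise_extendable \<sigma> E p (\<Union>k. W k)"
  proof (rule metrizable_local_property[where Q = "fibrewise_extendable \<sigma> E p", OF B])
  qed (simp_all add: W fibrewise_extendable_open_subset[OF contp] fibrewise_extendable_Un[OF \<sigma> contp]
      fibrewise_extendable_UN_disjoint[OF \<sigma> contp])
  have pW: "p e \<in> (\<Union>k. W k)" if e: "e \<in> topspace E" for e
  proof -
    have "h e \<in> N (p e)" using V(2)[OF pB[OF e]] r_h[OF e] h_in[OF e] by (simp add: N_def)
    then have "h e \<in> \<Union>\<F>" using \<F>(3) pB[OF e] by blast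
    then obtain c where c: "c \<in> C" "h e \<in> N c" using C(3) by blast
    then obtain k where "from_nat_into C k = c" using C(1) by (metis from_nat_into_surj)
    then have "V c = W k" using c by (auto simp: W_def)
    moreover have "p e \<in> V c" using c(2) r_h[OF e] by (simp add: N_def)
    ultimately show ?thesis by blast
  qed
  have "fibrewise_symmetric \<sigma> E p (topspace B) S f \<longleftrightarrow> fibrewise_symmetric \<sigma> E p (\<Union>k. W k) S f" for S f
  proof -
    have "f y \<in> topspace E" if "continuous_map (top_of_set S) E f" "y \<in> S" for y
      using continuous_map_image_subset_topspace[OF that(1)] that(2) by auto
    then show ?thesis using pW pB unfolding fibrewise_symmetric_def by meson
  qed
  then show ?thesis using ext unfolding fibrewise_extendable_def by simp
qed

text \<open>The set \<open>A\<close> is the copy of the fibre square inside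
  \<open>\<Omega> \<times> \<Omega>\<close>: both coordinates are fixed by
  \<open>h \<circ> r\<close>, and their images in the base agree. These equations are closed because
  the spaces in question are Hausdorff. The map \<open>g\<close> extends the first projection of the
  fibre square, the involution being the swap.\<close>

lemma fibre_square_neighbourhood_map:
  assumes p: "locally_trivial_fibration E B p" and B: "metrizable_space B"
  obtains U g where "openin (top_of_set (topspace (Euclidean_space n) \<times> topspace (Euclidean_space n))) U"
    "\<And>x y. (x, y) \<in> U \<Longrightarrow> (y, x) \<in> U" "continuous_map (top_of_set U) E g"
    "\<And>x y. (x, y) \<in> U \<Longrightarrow> p (g (y, x)) = p (g (x, y))"
    "\<And>e e'. e \<in> topspace E \<Longrightarrow> e' \<in> topspace E \<Longrightarrow> p e = p e' \<Longrightarrow> (h e, h e') \<in> U \<and> g (h e, h e') = e"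
proof -
  have contp: "continuous_map E B p" using p by (simp add: locally_trivial_fibration_def)
  define Y where "Y = \<Omega> \<times> \<Omega>"
  have swap: "continuous_on UNIV (prod.swap :: (nat \<Rightarrow> real) \<times> (nat \<Rightarrow> real) \<Rightarrow> _)"
    by (simp add: continuous_on_swap)
  have fst: "continuous_map (top_of_set Y) (top_of_set \<Omega>) fst" and snd: "continuous_map (top_of_set Y) (top_of_set \<Omega>) snd"
    by (auto simp: continuous_map_in_subtopology Y_def intro: continuous_on_fst[OF continuous_on_id] continuous_on_snd[OF continuous_on_id])
  note rf = continuous_map_compose[OF fst r] continuous_map_compose[OF snd r]
  have eu: "continuous_map (top_of_set Y) euclidean f" if "continuous_map (top_of_set Y) (top_of_set \<Omega>) f" for f
    using that by (rule continuous_map_into_fulltopology)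
  have Hd: "Hausdorff_space (euclidean :: (nat \<Rightarrow> real) topology)"
    by (simp add: metrizable_imp_Hausdorff_space metrizable_space_euclidean)
  define A where "A = {z \<in> Y. h (r (fst z)) = fst z} \<inter> {z \<in> Y. h (r (snd z)) = snd z} \<inter> {z \<in> Y. p (r (fst z)) = p (r (snd z))}"
  have "closedin (top_of_set Y) {z \<in> topspace (top_of_set Y). (h \<circ> (r \<circ> fst)) z = fst z}"
    "closedin (top_of_set Y) {z \<in> topspace (top_of_set Y). (h \<circ> (r \<circ> snd)) z = snd z}"
    by (intro closedin_continuous_maps_eq[OF Hd] eu continuous_map_compose[OF rf(1) h] continuous_map_compose[OF rf(2) h] fst snd)+
  moreover have "closedin (top_of_set Y) {z \<in> topspace (top_of_set Y). (p \<circ> (r \<circ> fst)) z = (p \<circ> (r \<circ> snd)) z}"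
    by (intro closedin_continuous_maps_eq[OF metrizable_imp_Hausdorff_space[OF B]]
        continuous_map_compose[OF rf(1) contp] continuous_map_compose[OF rf(2) contp])
  ultimately have A: "closedin (top_of_set Y) A"
    unfolding A_def by (intro closedin_Int) (simp_all add: o_def)
  have AY: "A \<subseteq> Y" by (auto simp: A_def)
  have rE: "r x \<in> topspace E" if "x \<in> \<Omega>" for x
    using continuous_map_image_subset_topspace[OF r] that by auto
  have pB: "p e \<in> topspace B" if "e \<in> topspace E" for e
    using continuous_map_image_subset_topspace[OF contp] that by auto
  have f: "fibrewise_symmetric prod.swap E p (topspace B) A (r \<circ> fst)"
    unfolding fibrewise_symmetric_def
    using continuous_map_from_subtopology_mono[OF rf(1) AY] rE pB by (auto simp: A_def Y_def)
  have invY: "prod.swap ` Y \<subseteq> Y" by (auto simp: Y_def)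
  obtain U g where U: "openin (top_of_set Y) U" "A \<subseteq> U" and g: "fibrewise_symmetric prod.swap E p (topspace B) U g"
    and gA: "\<And>z. z \<in> A \<Longrightarrow> g z = (r \<circ> fst) z"
    using fibrewise_extendableE[OF fibrewise_extendable_topspace[OF swap swap_swap p B] invY A f] by blast
  have hA: "(h e, h e') \<in> A" if "e \<in> topspace E" "e' \<in> topspace E" "p e = p e'" for e e'
    using that by (simp add: A_def Y_def r_h h_in)
  show thesis
  proof (rule that[of U g])
    have "openin (prod_topology (Euclidean_space n) (Euclidean_space n)) Y"
      unfolding Y_def by (simp add: openin_prod_Times_iff open_\<Omega>)
    then have "openin (top_of_set (topspace (Euclidean_space n) \<times> topspace (Euclidean_space n))) Y"
      by (simp add: Euclidean_space_eq)
    then show "openin (top_of_set (topspace (Euclidean_space n) \<times> topspace (Euclidean_space n))) U"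
      using U(1) openin_trans by blast
    show "(y, x) \<in> U" "p (g (y, x)) = p (g (x, y))" if "(x, y) \<in> U" for x y
      using g that by (force simp: fibrewise_symmetric_def)+
    show "continuous_map (top_of_set U) E g" using g by (simp add: fibrewise_symmetric_def)
    show "(h e, h e') \<in> U \<and> g (h e, h e') = e" if "e \<in> topspace E" "e' \<in> topspace E" "p e = p e'" for e e'
      using hA[OF that] U(2) gA[OF hA[OF that]] r_h[OF that(1)] by auto
  qed
qed

end

subsection \<open>Equivariant NDR pairs\<close>

text \<open>A given map is composed with an equivariant retraction \<open>R\<close> of the cylinder
  onto \<open>Z\<close>. It moves \<open>(k, t)\<close> along \<open>H\<close> for the time
  \<open>min 1 (t / w k)\<close> and lowers the height to \<open>max 0 (t - w k)\<close>. If the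
  height stays positive, then \<open>w k < t \<le> 1\<close> and, off \<open>L\<close>, the
  deformation has run its full time, so the point has arrived in \<open>L\<close>.\<close>

lemma NDR_imp_closed_G_cofibration_inclusion:
  fixes K :: "'x topology" and w :: "'x \<Rightarrow> real"
  assumes G: "G_space G K a" and L: "closedin K L" "G_invariant G a L"
    and w: "continuous_map K euclideanreal w" "\<And>k. k \<in> topspace K \<Longrightarrow> 0 \<le> w k"
      "\<And>k. k \<in> topspace K \<Longrightarrow> w k = 0 \<longleftrightarrow> k \<in> L"
    and wG: "\<And>g k. g \<in> carrier G \<Longrightarrow> k \<in> topspace K \<Longrightarrow> w (a g k) = w k"
    and H: "continuous_map (prod_topology K (top_of_set {0..1::real})) K H"
    and H0: "\<And>k. k \<in> topspace K \<Longrightarrow> H (k, 0) = k"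
    and HL: "\<And>k t. k \<in> L \<Longrightarrow> t \<in> {0..1} \<Longrightarrow> H (k, t) = k"
    and H1: "\<And>k. k \<in> topspace K \<Longrightarrow> w k < 1 \<Longrightarrow> H (k, 1) \<in> L"
    and HG: "\<And>g k t. g \<in> carrier G \<Longrightarrow> k \<in> topspace K \<Longrightarrow> t \<in> {0..1} \<Longrightarrow> H (a g k, t) = a g (H (k, t))"
  shows "closed_G_cofibration_inclusion T G K a L"
proof -
  let ?I = "{0..1::real}"
  define X where "X = prod_topology K (top_of_set ?I)"
  have topX: "topspace X = topspace K \<times> ?I" by (simp add: X_def)
  define Z where "Z = topspace K \<times> {0} \<union> L \<times> ?I"
  define c where "c z = min 1 (snd z / w (fst z))" for z :: "'x \<times> real"
  have c: "c z \<in> ?I" if "z \<in> topspace X" for z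
    using that w(2)[of "fst z"] by (auto simp: c_def topX)
  \<comment> \<open>\<open>c\<close> is discontinuous on \<open>L \<times> {0}\<close>, which does no harm because \<open>H\<close> is constant along \<open>L\<close>;
    on the rest of \<open>L \<times> ?I\<close> it takes the junk value \<open>0\<close> of a division by zero.\<close>
  define \<Phi> where "\<Phi> z = H (fst z, c z)" for z
  have fstX: "continuous_map X K fst" unfolding X_def by (rule continuous_map_fst)
  have wX: "continuous_map X euclideanreal (\<lambda>z. w (fst z))"
    using continuous_map_compose[OF fstX w(1)] by (simp add: o_def)
  have sndX: "continuous_map X euclideanreal snd"
    unfolding X_def using continuous_map_into_fulltopology[OF continuous_map_snd] by blast
  define P where "P = {z \<in> topspace X. w (fst z) \<in> {0<..}}"
  have P: "openin X P" unfolding P_def by (rule openin_continuous_map_preimage[OF wX]) auto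
  have PX: "P \<subseteq> topspace X" by (auto simp: P_def)
  have contP: "continuous_map (subtopology X P) K \<Phi>"
  proof -
    have "continuous_map (subtopology X P) euclideanreal c"
      unfolding c_def
      by (intro continuous_intros continuous_map_from_subtopology wX sndX) (auto simp: P_def)
    then have "continuous_map (subtopology X P) (top_of_set ?I) c"
      using c by (auto simp: continuous_map_in_subtopology)
    with continuous_map_from_subtopology[OF fstX]
    have "continuous_map (subtopology X P) (prod_topology K (top_of_set ?I)) (\<lambda>z. (fst z, c z))"
      by (rule continuous_map_pairedI)
    from continuous_map_compose[OF this H] show ?thesis by (simp add: o_def \<Phi>_def[abs_def])
  qed
  have \<Phi>K: "\<Phi> z \<in> topspace K" if "z \<in> topspace X" for z
  proof -
    have "(fst z, c z) \<in> topspace X" using that c[OF that] by (auto simp: topX)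
    then show ?thesis
      using continuous_map_image_subset_topspace[OF H] unfolding \<Phi>_def X_def by blast
  qed
  have \<Phi>L: "\<Phi> z = fst z" if "fst z \<in> L" "z \<in> topspace X" for z
    using HL[OF that(1) c[OF that(2)]] by (simp add: \<Phi>_def)
  have \<Phi>: "continuous_map X K \<Phi>"
    unfolding continuous_map_eq_topcontinuous_at topcontinuous_at_def
  proof (intro ballI conjI allI impI)
    fix z N assume z: "z \<in> topspace X" and N: "openin K N \<and> \<Phi> z \<in> N"
    show "\<exists>U. openin X U \<and> z \<in> U \<and> (\<forall>y\<in>U. \<Phi> y \<in> N)"
    proof (cases "z \<in> P")
      case True
      have "openin (subtopology X P) {y \<in> topspace (subtopology X P). \<Phi> y \<in> N}"
        using contP N by (intro openin_continuous_map_preimage) auto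
      then have "openin X {y \<in> topspace (subtopology X P). \<Phi> y \<in> N}"
        using P openin_trans_full by blast
      then show ?thesis using True PX N by (intro exI[of _ "{y \<in> topspace (subtopology X P). \<Phi> y \<in> N}"]) auto
    next
      case False
      then have zL: "fst z \<in> L" and zK: "fst z \<in> topspace K"
        using z w(2,3)[of "fst z"] by (auto simp: P_def topX)
      \<comment> \<open>Near \<open>L\<close> continuity does not depend on \<open>c\<close>: all of
        \<open>{fst z} \<times> ?I\<close> goes into \<open>N\<close>, and by the tube lemma so does
        \<open>U \<times> ?I\<close> for a neighbourhood \<open>U\<close> of
        \<open>fst z\<close>.\<close>
      define M where "M = {y \<in> topspace X. H y \<in> N}"
      have M: "openin (prod_topology K (top_of_set ?I)) M"
        unfolding M_def X_def using H N by (intro openin_continuous_map_preimage) auto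
      have "{fst z} \<times> ?I \<subseteq> M"
        using \<Phi>L[OF zL z] HL[OF zL] N zK by (auto simp: M_def topX)
      then obtain U V where UV: "openin K U" "fst z \<in> U" "?I \<subseteq> V" "U \<times> V \<subseteq> M"
        using tube_lemma_right[OF M _ zK, of ?I] by (auto simp: compactin_subtopology)
      have "openin X (U \<times> ?I)" unfolding X_def using UV(1) by (simp add: openin_prod_Times_iff)
      moreover have "z \<in> U \<times> ?I" using UV(2) z by (auto simp: topX mem_Times_iff)
      moreover have "\<Phi> y \<in> N" if "y \<in> U \<times> ?I" for y
      proof -
        have "y \<in> topspace X" using that openin_subset[OF UV(1)] by (auto simp: topX)
        then have "(fst y, c y) \<in> U \<times> V" using that c UV(3) by auto
        then show ?thesis using UV(4) by (auto simp: \<Phi>_def M_def)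
      qed
      ultimately show ?thesis by blast
    qed
  qed (use \<Phi>K in auto)
  define R where "R z = (\<Phi> z, max 0 (snd z - w (fst z)))" for z
  have RZ: "R z \<in> Z" if z: "z \<in> topspace X" for z
  proof (cases "snd z \<le> w (fst z)")
    case True
    then show ?thesis using \<Phi>K[OF z] by (simp add: R_def Z_def)
  next
    case False
    have zK: "fst z \<in> topspace K" "snd z \<le> 1" using z by (auto simp: topX)
    have "\<Phi> z \<in> L"
    proof (cases "fst z \<in> L")
      case True then show ?thesis using \<Phi>L[OF _ z] by simp
    next
      case nL: False
      then have "w (fst z) > 0" using w(2,3) zK by force
      then have "c z = 1" using False by (simp add: c_def)
      then show ?thesis using H1[OF zK(1)] False zK(2) by (simp add: \<Phi>_def)
    qed
    then show ?thesis using False zK w(2)[OF zK(1)] by (simp add: R_def Z_def)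
  qed
  have R: "continuous_map X (subtopology X Z) R"
  proof -
    have "continuous_map X euclideanreal (\<lambda>z. max 0 (snd z - w (fst z)))"
      by (intro continuous_intros wX sndX)
    moreover have "max 0 (snd z - w (fst z)) \<in> ?I" if "z \<in> topspace X" for z
      using that w(2)[of "fst z"] by (auto simp: topX)
    ultimately have "continuous_map X (top_of_set ?I) (\<lambda>z. max 0 (snd z - w (fst z)))"
      by (auto simp: continuous_map_in_subtopology)
    with \<Phi> have "continuous_map X X R"
      unfolding R_def by (subst (2) X_def) (rule continuous_map_pairedI)
    then show ?thesis using RZ by (auto simp: continuous_map_in_subtopology)
  qed
  have R_id: "R z = z" if zZ: "z \<in> Z" for z
  proof -
    consider "fst z \<in> topspace K" "snd z = 0" | "fst z \<in> L" "snd z \<in> ?I" using zZ by (auto simp: Z_def)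
    then show ?thesis
    proof cases
      case 1
      then have "\<Phi> z = fst z" using H0 by (simp add: \<Phi>_def c_def)
      then show ?thesis using 1 w(2)[OF 1(1)] by (simp add: R_def prod_eq_iff)
    next
      case 2
      then have K: "fst z \<in> topspace K" using closedin_subset[OF L(1)] by auto
      then have "z \<in> topspace X" using 2 by (auto simp: topX mem_Times_iff)
      then have "\<Phi> z = fst z" using \<Phi>L 2 by blast
      then show ?thesis using 2 w(3)[OF K] by (simp add: R_def prod_eq_iff)
    qed
  qed
  define A where "A g z = (case z of (x, t) \<Rightarrow> (a g x, t))" for g and z :: "'x \<times> real"
  have aK: "a g k \<in> topspace K" if "g \<in> carrier G" "k \<in> topspace K" for g k
    using G that unfolding G_space_def by (metis continuous_map_image_subset_topspace image_subset_iff)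
  have R_equiv: "R (A g z) = A g (R z)" if "g \<in> carrier G" "z \<in> topspace X" for g z
  proof -
    obtain k t where z: "z = (k, t)" by (cases z)
    have "k \<in> topspace K" using that z by (simp add: topX)
    then show ?thesis using wG[OF that(1)] HG[OF that(1) _ c[OF that(2)]]
      by (simp add: z R_def \<Phi>_def c_def A_def)
  qed
  have "\<exists>F. G_map G X A Y d F \<and> (\<forall>z\<in>Z. F z = f z)"
    if f: "G_map G (subtopology X Z) A Y d f" for Y :: "'y topology" and d f
  proof (intro exI[of _ "f \<circ> R"] conjI)
    have "continuous_map X Y (f \<circ> R)"
      using f R unfolding G_map_def by (blast intro: continuous_map_compose)
    moreover have "(f \<circ> R) (A g z) = d g ((f \<circ> R) z)" if "g \<in> carrier G" "z \<in> topspace X" for g z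
    proof -
      have "R z \<in> topspace (subtopology X Z)"
        using continuous_map_image_subset_topspace[OF R] that(2) by blast
      then show ?thesis using f R_equiv[OF that] that(1) by (simp add: G_map_def)
    qed
    ultimately show "G_map G X A Y d (f \<circ> R)" by (simp add: G_map_def)
    show "\<forall>z\<in>Z. (f \<circ> R) z = f z" using R_id by simp
  qed
  then show ?thesis
    using G L unfolding closed_G_cofibration_inclusion_def Let_def X_def Z_def A_def by blast
qed

subsection \<open>The fibre square\<close>

text \<open>The retraction of \<open>\<Omega>\<close> onto the image of \<open>h\<close> is followed
  by the inverse homeomorphism back to \<open>E\<close>.\<close>

lemma ENR_spaceE:
  assumes "ENR_space E"
  obtains n \<Omega> h r where "neighbourhood_retract E n \<Omega> h r"
proof -
  obtain n \<rho> h where emb: "embedding_map E (Euclidean_space n) h"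
    and nr: "G_neighborhood_retract (singleton_group ()) (Euclidean_space n) \<rho> (h ` topspace E)"
    using assms unfolding ENR_space_def G_ENR_def by blast
  let ?S = "h ` topspace E"
  obtain \<Omega> s where \<Omega>: "openin (Euclidean_space n) \<Omega>"
    and S_top: "?S \<subseteq> topspace (subtopology (Euclidean_space n) \<Omega>)"
    and s_map: "G_map (singleton_group ()) (subtopology (Euclidean_space n) \<Omega>) \<rho>
      (subtopology (subtopology (Euclidean_space n) \<Omega>) ?S) \<rho> s"
    and s_id: "\<forall>x\<in>?S. s x = x"
    using nr unfolding G_neighborhood_retract_def G_retract_def by blast
  have s: "continuous_map (subtopology (Euclidean_space n) \<Omega>) (subtopology (subtopology (Euclidean_space n) \<Omega>) ?S) s"
    using s_map by (simp add: G_map_def)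
  have S\<Omega>: "?S \<subseteq> \<Omega>" using S_top by auto
  have \<Omega>_eq: "subtopology (Euclidean_space n) \<Omega> = top_of_set \<Omega>"
    using openin_subset[OF \<Omega>] by (simp add: Euclidean_space_eq subtopology_subtopology Int_absorb1)
  have S_eq: "subtopology (subtopology (Euclidean_space n) \<Omega>) ?S = subtopology (Euclidean_space n) ?S"
    using S\<Omega> by (simp add: subtopology_subtopology Int_absorb1)
  obtain k where "homeomorphic_maps E (subtopology (Euclidean_space n) ?S) h k"
    using emb unfolding embedding_map_def homeomorphic_map_maps by blast
  then have h: "continuous_map E (subtopology (Euclidean_space n) ?S) h"
    and k: "continuous_map (subtopology (Euclidean_space n) ?S) E k" and kh: "\<And>e. e \<in> topspace E \<Longrightarrow> k (h e) = e"
    unfolding homeomorphic_maps_def by auto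
  have "neighbourhood_retract E n \<Omega> h (k \<circ> s)"
  proof
    show "continuous_map E (top_of_set \<Omega>) h"
      using h S\<Omega> unfolding \<Omega>_eq[symmetric] by (auto simp: continuous_map_in_subtopology)
    show "continuous_map (top_of_set \<Omega>) E (k \<circ> s)"
      using continuous_map_compose[OF s[unfolded S_eq] k] by (simp add: \<Omega>_eq)
    show "(k \<circ> s) (h e) = e" if "e \<in> topspace E" for e using that by (simp add: s_id kh)
  qed (rule \<Omega>)
  then show thesis by (rule that)
qed

section \<open>The swap as a linear representation\<close>

lemma carrier_Z2: "carrier Z2 = {0, 1}"
  by (auto simp: Z2_def carrier_integer_mod_group)

lemma G_space_Z2:
  assumes "continuous_map X X \<tau>" "\<And>x. x \<in> topspace X \<Longrightarrow> \<tau> (\<tau> x) = x"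
  shows "G_space Z2 X (\<lambda>g. if g = 0 then id else \<tau>)"
proof -
  have "(\<lambda>x. x) = id" by (simp add: fun_eq_iff)
  moreover have "\<one>\<^bsub>Z2\<^esub> = 0" "\<And>x y. x \<otimes>\<^bsub>Z2\<^esub> y = (x + y) mod 2" "group Z2" by (simp_all add: Z2_def)
  ultimately show ?thesis
    using assms unfolding G_space_def by (auto simp: carrier_Z2 continuous_map_id[unfolded id_def])
qed

text \<open>Identifies pairs of sequences with sequences by even and odd indices. Unlike
  concatenation, the formula does not depend on \<open>n\<close>, and it carries pairs from
  \<open>Euclidean_space n\<close> to \<open>Euclidean_space (2 * n)\<close>.\<close>

definition interleave :: "(nat \<Rightarrow> real) \<times> (nat \<Rightarrow> real) \<Rightarrow> nat \<Rightarrow> real" where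
  "interleave z i = (if even i then fst z (i div 2) else snd z (i div 2))"

definition deinterleave :: "(nat \<Rightarrow> real) \<Rightarrow> (nat \<Rightarrow> real) \<times> (nat \<Rightarrow> real)" where
  "deinterleave x = ((\<lambda>i. x (2 * i)), (\<lambda>i. x (2 * i + 1)))"

lemma deinterleave_interleave [simp]: "deinterleave (interleave z) = z"
  by (simp add: deinterleave_def interleave_def)

lemma interleave_deinterleave [simp]: "interleave (deinterleave x) = x"
  by (auto simp: deinterleave_def interleave_def fun_eq_iff elim!: evenE oddE)

lemma continuous_on_interleave: "continuous_on UNIV interleave"
proof (rule continuous_on_coordinatewise_then_product)
  fix i
  show "continuous_on UNIV (\<lambda>z. interleave z i)"
    by (cases "even i")
      (simp_all add: interleave_def continuous_on_product_then_coordinatewise[OF continuous_on_fst[OF continuous_on_id]]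
        continuous_on_product_then_coordinatewise[OF continuous_on_snd[OF continuous_on_id]])
qed

lemma continuous_on_deinterleave: "continuous_on UNIV deinterleave"
  unfolding deinterleave_def
  by (intro continuous_on_Pair continuous_on_coordinatewise_then_product continuous_on_product_coordinates)

lemma interleave_image:
  "interleave z \<in> topspace (Euclidean_space (2 * n)) \<longleftrightarrow>
     z \<in> topspace (Euclidean_space n) \<times> topspace (Euclidean_space n)"
proof
  assume z: "interleave z \<in> topspace (Euclidean_space (2 * n))"
  have "fst z i = 0 \<and> snd z i = 0" if "i \<ge> n" for i
  proof -
    have "interleave z (2 * i) = 0" "interleave z (2 * i + 1) = 0"
      using z that by (auto simp: topspace_Euclidean_space)
    then show ?thesis by (simp add: interleave_def)
  qed
  then show "z \<in> topspace (Euclidean_space n) \<times> topspace (Euclidean_space n)"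
    by (auto simp: topspace_Euclidean_space mem_Times_iff)
next
  assume "z \<in> topspace (Euclidean_space n) \<times> topspace (Euclidean_space n)"
  moreover have "i div 2 \<ge> n" if "i \<ge> 2 * n" for i using that by simp
  ultimately show "interleave z \<in> topspace (Euclidean_space (2 * n))"
    by (auto simp: topspace_Euclidean_space interleave_def mem_Times_iff)
qed

text \<open>In coordinates this exchanges the entries with indices \<open>2 * i\<close> and
  \<open>2 * i + 1\<close>.\<close>

definition interleaved_swap :: "(nat \<Rightarrow> real) \<Rightarrow> nat \<Rightarrow> real" where
  "interleaved_swap x = interleave (prod.swap (deinterleave x))"

lemma deinterleave_image:
  "deinterleave x \<in> topspace (Euclidean_space n) \<times> topspace (Euclidean_space n) \<longleftrightarrow>
     x \<in> topspace (Euclidean_space (2 * n))"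
  using interleave_image[of "deinterleave x" n] by simp

lemma G_representation_interleaved_swap:
  "G_representation Z2 (2 * n) (\<lambda>g. if g = 0 then id else interleaved_swap)"
proof -
  have "continuous_on UNIV interleaved_swap"
    unfolding interleaved_swap_def
    by (intro continuous_on_compose2[OF continuous_on_interleave] continuous_on_compose2[OF continuous_on_swap]
        continuous_on_deinterleave) auto
  moreover have "interleaved_swap x \<in> topspace (Euclidean_space (2 * n))" if "x \<in> topspace (Euclidean_space (2 * n))" for x
    using that unfolding deinterleave_image[symmetric] by (auto simp: interleaved_swap_def)
  ultimately have "continuous_map (Euclidean_space (2 * n)) (Euclidean_space (2 * n)) interleaved_swap"
    unfolding Euclidean_space_eq
    by (auto simp: continuous_map_in_subtopology topspace_Euclidean_space intro: continuous_on_subset)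
  then have "G_space Z2 (Euclidean_space (2 * n)) (\<lambda>g. if g = 0 then id else interleaved_swap)"
    by (rule G_space_Z2) (simp add: interleaved_swap_def)
  moreover have "interleaved_swap (\<lambda>i. s * x i + t * y i) = (\<lambda>i. s * interleaved_swap x i + t * interleaved_swap y i)" for s t x y
    by (auto simp: interleaved_swap_def interleave_def deinterleave_def fun_eq_iff)
  ultimately show ?thesis by (simp add: G_representation_def)
qed

section \<open>The fibre square as a space with involution\<close>

lemma topspace_fibre_square:
  "topspace (fibre_square E p) = {(e1, e2). e1 \<in> topspace E \<and> e2 \<in> topspace E \<and> p e1 = p e2}"
  by (auto simp: fibre_square_def)

lemma continuous_map_into_fibre_square:
  assumes "continuous_map X E f" "continuous_map X E g" "\<And>x. x \<in> topspace X \<Longrightarrow> p (f x) = p (g x)"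
  shows "continuous_map X (fibre_square E p) (\<lambda>x. (f x, g x))"
  using assms by (auto simp: fibre_square_def continuous_map_in_subtopology intro: continuous_map_pairedI)

lemma continuous_map_fst_fibre_square: "continuous_map (fibre_square E p) E fst"
  and continuous_map_snd_fibre_square: "continuous_map (fibre_square E p) E snd"
  unfolding fibre_square_def by (auto intro: continuous_map_from_subtopology continuous_map_fst continuous_map_snd)

lemma continuous_map_swap_fibre_square: "continuous_map (fibre_square E p) (fibre_square E p) prod.swap"
  using continuous_map_into_fibre_square[OF continuous_map_snd_fibre_square continuous_map_fst_fibre_square, of E p p]
  by (simp add: prod.swap_def[abs_def] topspace_fibre_square split_beta)

lemma G_space_fibre_square: "G_space Z2 (fibre_square E p) transposition_action"
  using G_space_Z2[OF continuous_map_swap_fibre_square] by (simp add: transposition_action_def[abs_def])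

lemma (in neighbourhood_retract) continuous_map_h_h:
  "continuous_map (fibre_square E p) euclidean (\<lambda>z. (h (fst z), h (snd z)))"
proof -
  have h': "continuous_map E euclidean h" using h by (rule continuous_map_into_fulltopology)
  have "continuous_map (fibre_square E p) (prod_topology euclidean euclidean) (\<lambda>z. ((h \<circ> fst) z, (h \<circ> snd) z))"
    by (intro continuous_map_pairedI continuous_map_compose[OF continuous_map_fst_fibre_square h']
        continuous_map_compose[OF continuous_map_snd_fibre_square h'])
  then show ?thesis by simp
qed

text \<open>The map sending \<open>z\<close> to \<open>(g z, g (prod.swap z))\<close> is equivariant
  and, by \<open>pg\<close>, lands in the fibre square. By \<open>gh\<close> it is left inverse to
  applying \<open>h\<close> in both coordinates. Interleaving carries everything to
  \<open>Euclidean_space (2 * n)\<close>.\<close>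

lemma (in neighbourhood_retract) G_ENR_fibre_square:
  assumes U: "openin (top_of_set (topspace (Euclidean_space n) \<times> topspace (Euclidean_space n))) U"
    and swapU: "\<And>x y. (x, y) \<in> U \<Longrightarrow> (y, x) \<in> U" and g: "continuous_map (top_of_set U) E g"
    and pg: "\<And>x y. (x, y) \<in> U \<Longrightarrow> p (g (y, x)) = p (g (x, y))"
    and gh: "\<And>e e'. e \<in> topspace E \<Longrightarrow> e' \<in> topspace E \<Longrightarrow> p e = p e' \<Longrightarrow> (h e, h e') \<in> U \<and> g (h e, h e') = e"
  shows "G_ENR Z2 (fibre_square E p) transposition_action"
proof -
  define K where "K = fibre_square E p"
  define V where "V = Euclidean_space (2 * n)"
  define \<rho> where "\<rho> g = (if g = 0 then id else interleaved_swap)" for g :: int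
  define H where "H z = interleave (h (fst z), h (snd z))" for z
  define R where "R x = (g (deinterleave x), g (prod.swap (deinterleave x)))" for x
  define U' where "U' = {x \<in> topspace V. deinterleave x \<in> U}"
  let ?S = "H ` topspace K"
  have V_eq: "V = top_of_set (topspace V)" by (simp add: V_def Euclidean_space_eq)
  have topK: "topspace K = {(e1, e2). e1 \<in> topspace E \<and> e2 \<in> topspace E \<and> p e1 = p e2}"
    unfolding K_def by (rule topspace_fibre_square)
  have hV: "h e \<in> topspace (Euclidean_space n)" if "e \<in> topspace E" for e
    using h_in[OF that] openin_subset[OF open_\<Omega>] by blast
  have HV: "H z \<in> topspace V" if "z \<in> topspace K" for z
    using that hV by (auto simp: V_def H_def interleave_image topK)
  have HU: "H z \<in> U'" if "z \<in> topspace K" for z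
    using that HV[OF that] gh by (auto simp: U'_def H_def topK)
  have H: "continuous_map K V H"
  proof -
    have "continuous_map K euclidean (interleave \<circ> (\<lambda>z. (h (fst z), h (snd z))))"
      using continuous_on_interleave unfolding K_def
      by (intro continuous_map_compose[OF continuous_map_h_h]) simp
    then show ?thesis
      using HV by (subst V_eq) (auto simp: continuous_map_in_subtopology H_def[abs_def] o_def)
  qed
  have swap_de: "continuous_map (top_of_set U') (top_of_set U) (\<lambda>x. prod.swap (deinterleave x))"
    and de: "continuous_map (top_of_set U') (top_of_set U) deinterleave"
  proof -
    have sw: "prod.swap z \<in> U" if "z \<in> U" for z using swapU[of "fst z" "snd z"] that by (simp add: prod.swap_def)
    have "continuous_on U' deinterleave"
      using continuous_on_subset[OF continuous_on_deinterleave] by simp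
    moreover from this have "continuous_on U' (\<lambda>x. prod.swap (deinterleave x))"
      by (rule continuous_on_compose2[OF continuous_on_swap[of UNIV]]) simp
    ultimately show "continuous_map (top_of_set U') (top_of_set U) (\<lambda>x. prod.swap (deinterleave x))"
      "continuous_map (top_of_set U') (top_of_set U) deinterleave"
      using sw by (auto simp: continuous_map_in_subtopology U'_def)
  qed
  have R: "continuous_map (top_of_set U') K R"
    unfolding R_def[abs_def] K_def
  proof (rule continuous_map_into_fibre_square)
    show "continuous_map (top_of_set U') E (\<lambda>x. g (deinterleave x))"
      using continuous_map_compose[OF de g] by (simp add: o_def)
    show "continuous_map (top_of_set U') E (\<lambda>x. g (prod.swap (deinterleave x)))"
      using continuous_map_compose[OF swap_de g] by (simp add: o_def)
    show "p (g (deinterleave x)) = p (g (prod.swap (deinterleave x)))" if "x \<in> topspace (top_of_set U')" for x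
      using that pg[of "fst (deinterleave x)" "snd (deinterleave x)"] by (simp add: U'_def prod.swap_def)
  qed
  have RH: "R (H z) = z" if "z \<in> topspace K" for z
    using that gh by (auto simp: R_def H_def topK)
  have subU': "subtopology V U' = top_of_set U'"
    by (subst V_eq) (auto simp: subtopology_subtopology U'_def Int_absorb1)
  have RK: "R x \<in> topspace K" if "x \<in> U'" for x
    using continuous_map_image_subset_topspace[OF R] that by auto
  have opU': "openin V U'"
  proof -
    have "openin (top_of_set (topspace V)) (topspace V \<inter> deinterleave -` U)"
    proof (rule continuous_openin_preimage[OF continuous_on_subset[OF continuous_on_deinterleave] _ U])
      show "deinterleave \<in> topspace V \<rightarrow> topspace (Euclidean_space n) \<times> topspace (Euclidean_space n)"
        using deinterleave_image by (auto simp: V_def)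
    qed simp
    moreover have "U' = topspace V \<inter> deinterleave -` U" by (auto simp: U'_def)
    ultimately show ?thesis using V_eq by simp
  qed
  have H_swap: "H (prod.swap z) = interleaved_swap (H z)" for z by (simp add: H_def interleaved_swap_def)
  have H_equiv: "H (transposition_action i z) = \<rho> i (H z)" for i z
    by (simp add: \<rho>_def transposition_action_def H_swap)
  have K_equiv: "transposition_action i z \<in> topspace K" if "z \<in> topspace K" for i z
    using that by (auto simp: transposition_action_def topK)
  have R_equiv: "R (\<rho> i x) = transposition_action i (R x)" for i x
    by (simp add: R_def \<rho>_def transposition_action_def interleaved_swap_def)
  have \<rho>U': "\<rho> i x \<in> U'" if "x \<in> U'" for i x
    using that swapU deinterleave_image[of _ n]
    by (auto simp: \<rho>_def U'_def V_def interleaved_swap_def interleave_image prod.swap_def mem_Times_iff)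
  have emb: "embedding_map K V H"
    unfolding embedding_map_def
  proof (rule homeomorphic_maps_imp_map)
    show "homeomorphic_maps K (subtopology V ?S) H R"
      unfolding homeomorphic_maps_def
    proof (intro conjI ballI)
      have "subtopology V ?S = subtopology (top_of_set U') ?S"
        using HU unfolding subU'[symmetric] by (auto simp: subtopology_subtopology intro: arg_cong[where f = "subtopology V"])
      then show "continuous_map (subtopology V ?S) K R"
        using continuous_map_from_subtopology[OF R] by simp
    qed (use H HV RH in \<open>auto simp: continuous_map_in_subtopology\<close>)
  qed
  have "G_retract Z2 (subtopology V U') \<rho> ?S"
    unfolding G_retract_def
  proof (intro conjI exI[of _ "H \<circ> R"])
    show "?S \<subseteq> topspace (subtopology V U')" using HV HU by auto
    show "G_invariant Z2 \<rho> ?S" using H_equiv[symmetric] K_equiv by (auto simp: G_invariant_def)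
    have "continuous_map (subtopology V U') V (H \<circ> R)"
      unfolding subU' using R H by (rule continuous_map_compose)
    then show "G_map Z2 (subtopology V U') \<rho> (subtopology (subtopology V U') ?S) \<rho> (H \<circ> R)"
      using RK HU by (auto simp: G_map_def continuous_map_in_subtopology R_equiv H_equiv)
    show "\<forall>x\<in>?S. (H \<circ> R) x = x" using RH by auto
  qed
  then have "G_neighborhood_retract Z2 V \<rho> ?S"
    using opU' \<rho>U' by (auto simp: G_neighborhood_retract_def G_invariant_def)
  moreover have "G_map Z2 K transposition_action V \<rho> H" using H H_equiv by (simp add: G_map_def)
  moreover have "G_representation Z2 (2 * n) \<rho>"
    using G_representation_interleaved_swap unfolding \<rho>_def[abs_def] .
  ultimately show ?thesis
    using emb G_space_fibre_square unfolding G_ENR_def K_def V_def by blast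
qed

section \<open>The diagonal as an equivariant NDR\<close>

lemma (in neighbourhood_retract) metrizable_space_E: "metrizable_space E"
proof (rule metrizable_space_retraction_map_image[of "top_of_set \<Omega>" E r])
  have "retraction_maps (top_of_set \<Omega>) E r h"
    using r h r_h by (simp add: retraction_maps_def)
  then show "retraction_map (top_of_set \<Omega>) E r \<and> metrizable_space (top_of_set \<Omega>)"
    by (auto simp: retraction_map_def intro: metrizable_space_subtopology metrizable_space_euclidean)
qed

text \<open>Near the diagonal, the segment \<open>S k t\<close> stays in \<open>U\<close>, and
  applying \<open>g\<close> to it and to its swap gives a path in the fibre square. At time 1 the
  point is fixed by the swap, so the path ends on the diagonal. The functions \<open>v\<close> and
  \<open>l\<close> cut this motion off away from the diagonal.\<close>

lemma (in neighbourhood_retract) symmetrically_LEC_fibration: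
  assumes U: "openin (top_of_set (topspace (Euclidean_space n) \<times> topspace (Euclidean_space n))) U"
    and swapU: "\<And>x y. (x, y) \<in> U \<Longrightarrow> (y, x) \<in> U" and g: "continuous_map (top_of_set U) E g"
    and pg: "\<And>x y. (x, y) \<in> U \<Longrightarrow> p (g (y, x)) = p (g (x, y))"
    and gh: "\<And>e e'. e \<in> topspace E \<Longrightarrow> e' \<in> topspace E \<Longrightarrow> p e = p e' \<Longrightarrow> (h e, h e') \<in> U \<and> g (h e, h e') = e"
  shows "symmetrically_LEC T E p"
proof -
  let ?I = "{0..1::real}"
  let ?V = "topspace (Euclidean_space n)"
  define K where "K = fibre_square E p"
  define KI where "KI = prod_topology K (top_of_set ?I)"
  have topK: "topspace K = {(e1, e2). e1 \<in> topspace E \<and> e2 \<in> topspace E \<and> p e1 = p e2}"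
    unfolding K_def by (rule topspace_fibre_square)
  have topKI: "topspace KI = topspace K \<times> ?I" by (simp add: KI_def)
  have swapK: "prod.swap k \<in> topspace K" if "k \<in> topspace K" for k using that by (auto simp: topK)
  define L where "L = (\<lambda>e. (e, e)) ` topspace E"
  have L_iff: "k \<in> L \<longleftrightarrow> fst k = snd k" if "k \<in> topspace K" for k
    using that by (auto simp: L_def topK)
  have LK: "L \<subseteq> topspace K" by (auto simp: L_def topK)
  have clL: "closedin K L"
  proof -
    have "closedin K {k \<in> topspace K. fst k = snd k}"
      unfolding K_def
      by (intro closedin_continuous_maps_eq[OF metrizable_imp_Hausdorff_space[OF metrizable_space_E]]
          continuous_map_fst_fibre_square continuous_map_snd_fibre_square)
    moreover have "{k \<in> topspace K. fst k = snd k} = L" using L_iff LK by blast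
    ultimately show ?thesis by simp
  qed
  \<comment> \<open>The two coordinates move simultaneously to the midpoint of the segment between them.\<close>
  define S where "S k t = ((\<lambda>i. (1 - t / 2) * h (fst k) i + t / 2 * h (snd k) i),
                           (\<lambda>i. (1 - t / 2) * h (snd k) i + t / 2 * h (fst k) i))" for k t
  have S_swap: "S (prod.swap k) t = prod.swap (S k t)" for k t by (simp add: S_def)
  have S0: "S k 0 = (h (fst k), h (snd k))" for k by (simp add: S_def)
  have SL: "S k t = (h (fst k), h (snd k))" if "k \<in> L" for k t
    using that by (auto simp: S_def L_def algebra_simps)
  have S1: "prod.swap (S k 1) = S k 1" for k by (simp add: S_def add.commute)
  have S_cont: "continuous_map X (top_of_set (?V \<times> ?V)) (\<lambda>x. S (a x) (b x))"
    if a: "continuous_map X K a" and b: "continuous_map X euclideanreal b" for X :: "'x topology" and a b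
  proof -
    have h1: "continuous_map X euclideanreal (\<lambda>x. h (fst (a x)) i)"
      and h2: "continuous_map X euclideanreal (\<lambda>x. h (snd (a x)) i)" for i
      using continuous_map_compose[OF a[unfolded K_def] continuous_map_fst_fibre_square]
        continuous_map_compose[OF a[unfolded K_def] continuous_map_snd_fibre_square]
      by (auto simp: o_def intro: continuous_map_h_component)
    have "continuous_map X (prod_topology euclidean euclidean) (\<lambda>x. S (a x) (b x))"
      unfolding S_def euclidean_product_topology[symmetric] continuous_map_componentwise_UNIV
      by (intro continuous_map_pairedI) (auto simp: continuous_map_componentwise_UNIV intro!: continuous_intros h1 h2 b)
    moreover have "S (a x) (b x) \<in> ?V \<times> ?V" if "x \<in> topspace X" for x
    proof -
      have "a x \<in> topspace K" using continuous_map_image_subset_topspace[OF a] that by blast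
      moreover have "h e i = 0" if "e \<in> topspace E" "n \<le> i" for e i
        using \<Omega>_zero[OF h_in[OF that(1)] that(2)] .
      ultimately show ?thesis by (auto simp: S_def topspace_Euclidean_space topK)
    qed
    ultimately show ?thesis by (auto simp: continuous_map_in_subtopology)
  qed
  have fstKI: "continuous_map KI K fst" unfolding KI_def by (rule continuous_map_fst)
  have sndKI: "continuous_map KI euclideanreal snd"
    unfolding KI_def using continuous_map_into_fulltopology[OF continuous_map_snd] by blast
  define W where "W = {k \<in> topspace K. \<forall>t\<in>?I. S k t \<in> U}"
  have opW: "openin K W"
  proof (subst openin_subopen, intro ballI)
    fix k assume k: "k \<in> W"
    \<comment> \<open>As the time interval is compact, the tube lemma gives a neighbourhood of
      \<open>k\<close> on which all segments stay in \<open>U\<close>.\<close>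
    define M where "M = {z \<in> topspace KI. S (fst z) (snd z) \<in> U}"
    have M: "openin (prod_topology K (top_of_set ?I)) M"
      using openin_continuous_map_preimage[OF S_cont[OF fstKI sndKI] U] by (simp add: M_def KI_def)
    moreover have kK: "k \<in> topspace K" "{k} \<times> ?I \<subseteq> M" using k by (auto simp: W_def M_def topKI)
    ultimately obtain N N' where N: "openin K N" "k \<in> N" "?I \<subseteq> N'" "N \<times> N' \<subseteq> M"
      using tube_lemma_right[of K "top_of_set ?I" M ?I k] by (auto simp: compactin_subtopology)
    have "N \<subseteq> W"
    proof
      fix k' assume k': "k' \<in> N"
      have "S k' t \<in> U" if "t \<in> ?I" for t
      proof -
        have "(k', t) \<in> M" using N(3,4) k' that by blast
        then show ?thesis by (simp add: M_def)
      qed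
      then show "k' \<in> W" using openin_subset[OF N(1)] k' by (auto simp: W_def)
    qed
    then show "\<exists>T. openin K T \<and> k \<in> T \<and> T \<subseteq> W" using N by blast
  qed
  have LW: "L \<subseteq> W" using LK SL gh by (auto simp: W_def L_def)
  have metK: "metrizable_space K"
    unfolding K_def fibre_square_def
    by (intro metrizable_space_subtopology) (simp add: metrizable_space_prod_topology metrizable_space_E)
  have clW: "closedin K (topspace K - W)" using opW by (simp add: closedin_diff)
  have disj: "disjnt L (topspace K - W)" using LW by (auto simp: disjnt_def)
  obtain u where u: "continuous_map K (top_of_set ?I) u" "u ` L \<subseteq> {0}" "u ` (topspace K - W) \<subseteq> {1}"
    using Urysohn_lemma[OF metrizable_imp_normal_space[OF metK] clL clW disj, of 0 1] by auto
  have u_real: "continuous_map K euclideanreal u" using u(1) by (rule continuous_map_into_fulltopology)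
  have u_I: "u k \<in> ?I" if "k \<in> topspace K" for k using continuous_map_image_subset_topspace[OF u(1)] that by auto
  \<comment> \<open>The maximum makes the Urysohn function symmetric, and the distance term makes
    the zero set exactly \<open>L\<close>. Outside \<open>W\<close> the value is still 1.\<close>
  define v where "v k = min 1 (max (u k) (u (prod.swap k)) + dist (h (fst k)) (h (snd k)))" for k
  have v: "continuous_map K euclideanreal v"
  proof -
    have "continuous_map K euclideanreal (u \<circ> prod.swap)"
      using continuous_map_compose[OF continuous_map_swap_fibre_square] u_real unfolding K_def by blast
    moreover have "continuous_map euclidean euclideanreal (\<lambda>z :: (nat \<Rightarrow> real) \<times> (nat \<Rightarrow> real). dist (fst z) (snd z))"
      by (auto intro!: continuous_on_dist continuous_on_fst[OF continuous_on_id] continuous_on_snd[OF continuous_on_id])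
    from continuous_map_compose[OF continuous_map_h_h this]
    have "continuous_map K euclideanreal (\<lambda>k. dist (h (fst k)) (h (snd k)))"
      unfolding K_def by (simp add: o_def)
    ultimately show ?thesis unfolding v_def o_def by (intro continuous_intros u_real)
  qed
  have v_swap: "v (prod.swap k) = v k" for k by (simp add: v_def max.commute dist_commute)
  have v_nonneg: "0 \<le> v k" if "k \<in> topspace K" for k using u_I[OF that] by (simp add: v_def le_max_iff_disj)
  have v_L: "v k = 0 \<longleftrightarrow> k \<in> L" if k: "k \<in> topspace K" for k
  proof
    assume kL: "k \<in> L"
    then have "u k = 0" using u(2) by blast
    moreover have "prod.swap k = k" using kL by (auto simp: L_def)
    ultimately show "v k = 0" using L_iff[OF k] kL by (simp add: v_def)
  next
    assume "v k = 0"
    then have "max (u k) (u (prod.swap k)) + dist (h (fst k)) (h (snd k)) = 0" by (simp add: v_def min_def split: if_splits)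
    moreover have "max (u k) (u (prod.swap k)) \<ge> 0" using u_I[OF k] by (simp add: le_max_iff_disj)
    ultimately have "dist (h (fst k)) (h (snd k)) = 0" using zero_le_dist[of "h (fst k)" "h (snd k)"] by linarith
    then have "h (fst k) = h (snd k)" by simp
    moreover have "fst k \<in> topspace E" "snd k \<in> topspace E" using k by (auto simp: topK)
    ultimately have "fst k = snd k" using r_h by metis
    then show "k \<in> L" using L_iff k by blast
  qed
  have v_W: "k \<in> W" if "k \<in> topspace K" "v k < 1" for k
  proof (rule ccontr)
    assume "k \<notin> W"
    then have "u k = 1" using u(3) that(1) by auto
    then have "max (u k) (u (prod.swap k)) + dist (h (fst k)) (h (snd k)) \<ge> 1"
      using zero_le_dist[of "h (fst k)" "h (snd k)"] by linarith
    then show False using that(2) by (simp add: v_def)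
  qed
  \<comment> \<open>A damping factor for the time: it is 1 for \<open>v k \<le> 1/2\<close> and 0
    for \<open>v k \<ge> 3/4\<close>. The motion thus stops before \<open>v\<close> reaches 1, where
    the segment may leave \<open>U\<close>.\<close>
  define l where "l k = max 0 (min 1 (3 - 4 * v k))" for k
  have l: "l k \<in> ?I" for k by (auto simp: l_def)
  have l_swap: "l (prod.swap k) = l k" for k by (simp add: l_def v_swap)
  define \<Phi> where "\<Phi> z = (g (S (fst z) (snd z * l (fst z))), g (prod.swap (S (fst z) (snd z * l (fst z)))))" for z
  define H where "H z = (if v (fst z) < 1 then \<Phi> z else fst z)" for z
  have SU: "S k (t * l k) \<in> U" if "k \<in> topspace K" "v k < 1" "t \<in> ?I" for k t
    using v_W[OF that(1,2)] that(3) l[of k] by (auto simp: W_def mult_le_one)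
  have swapU': "prod.swap s \<in> U" if "s \<in> U" for s using swapU[of "fst s" "snd s"] that by (simp add: prod.swap_def)
  have \<Phi>_start: "(g (h (fst k), h (snd k)), g (prod.swap (h (fst k), h (snd k)))) = k" if "k \<in> topspace K" for k
    using that gh by (auto simp: topK)
  have vKI: "continuous_map KI euclideanreal (\<lambda>z. v (fst z))"
    using continuous_map_compose[OF fstKI v] by (simp add: o_def)
  have lKI: "continuous_map KI euclideanreal (\<lambda>z. snd z * l (fst z))"
    unfolding l_def by (intro continuous_intros vKI sndKI)
  have H: "continuous_map KI K H"
  \<comment> \<open>The two open sets \<open>v < 1\<close> and \<open>v > 3/4\<close> cover the
    cylinder; on their overlap \<open>l\<close> vanishes and \<open>\<Phi>\<close> is the
    projection.\<close>
  proof (rule pasting_lemma[where I = "UNIV :: bool set"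
        and T = "\<lambda>b. {z \<in> topspace KI. v (fst z) \<in> (if b then {..<1} else {3/4<..})}" and f = "\<lambda>b. if b then \<Phi> else fst"])
    show "openin KI {z \<in> topspace KI. v (fst z) \<in> (if b then {..<1} else {3/4<..})}" for b
      by (rule openin_continuous_map_preimage[OF vKI]) simp
    have "continuous_map (subtopology KI {z \<in> topspace KI. v (fst z) < 1}) K \<Phi>"
    proof -
      let ?X = "subtopology KI {z \<in> topspace KI. v (fst z) < 1}"
      have "continuous_map ?X (top_of_set (?V \<times> ?V)) (\<lambda>z. S (fst z) (snd z * l (fst z)))"
        by (intro continuous_map_from_subtopology S_cont fstKI lKI)
      then have s: "continuous_map ?X (top_of_set U) (\<lambda>z. S (fst z) (snd z * l (fst z)))"
        using SU by (auto simp: continuous_map_in_subtopology topKI)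
      have sw: "continuous_map (top_of_set U) (top_of_set U) prod.swap"
        using swapU' continuous_on_swap by (auto simp: continuous_map_in_subtopology)
      show ?thesis
        unfolding K_def \<Phi>_def[abs_def]
      proof (rule continuous_map_into_fibre_square)
        show "continuous_map ?X E (\<lambda>z. g (S (fst z) (snd z * l (fst z))))"
          using continuous_map_compose[OF s g] by (simp add: o_def)
        show "continuous_map ?X E (\<lambda>z. g (prod.swap (S (fst z) (snd z * l (fst z)))))"
          using continuous_map_compose[OF continuous_map_compose[OF s sw] g] by (simp add: o_def)
        show "p (g (S (fst z) (snd z * l (fst z)))) = p (g (prod.swap (S (fst z) (snd z * l (fst z)))))"
          if "z \<in> topspace ?X" for z
        proof -
          have "S (fst z) (snd z * l (fst z)) \<in> U" using that SU by (auto simp: topKI)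
          then show ?thesis
            using pg[of "fst (S (fst z) (snd z * l (fst z)))" "snd (S (fst z) (snd z * l (fst z)))"]
            by (simp add: prod.swap_def)
        qed
      qed
    qed
    then show "continuous_map (subtopology KI {z \<in> topspace KI. v (fst z) \<in> (if b then {..<1} else {3/4<..})}) K
        (if b then \<Phi> else fst)" for b
      using fstKI by (auto intro: continuous_map_from_subtopology)
    have "\<Phi> z = fst z" if "z \<in> topspace KI" "v (fst z) > 3 / 4" for z
    proof -
      have "l (fst z) = 0" using that(2) by (simp add: l_def)
      then show ?thesis using that(1) \<Phi>_start[of "fst z"] by (auto simp: \<Phi>_def S0 topKI)
    qed
    then show "(if b then \<Phi> else fst) z = (if b' then \<Phi> else fst) z"
      if "z \<in> topspace KI \<inter> {z \<in> topspace KI. v (fst z) \<in> (if b then {..<1} else {3/4<..})} \<inter>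
        {z \<in> topspace KI. v (fst z) \<in> (if b' then {..<1} else {3/4<..})}" for b b' z
      using that by (cases b; cases b') auto
    show "\<exists>b. b \<in> UNIV \<and> z \<in> {z \<in> topspace KI. v (fst z) \<in> (if b then {..<1} else {3/4<..})} \<and>
        H z = (if b then \<Phi> else fst) z" if "z \<in> topspace KI" for z
      using that by (intro exI[of _ "v (fst z) < 1"]) (auto simp: H_def)
  qed
  have inclusion: "closed_G_cofibration_inclusion T Z2 K transposition_action L"
  \<comment> \<open>The factor 2 turns the condition \<open>w k < 1\<close> into
    \<open>v k < 1/2\<close>, where \<open>l\<close> is 1 and the deformation reaches the
    diagonal.\<close>
  proof (rule NDR_imp_closed_G_cofibration_inclusion[where w = "\<lambda>k. 2 * v k" and H = H])
    show "G_space Z2 K transposition_action" unfolding K_def by (rule G_space_fibre_square)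
    show "closedin K L" by (rule clL)
    show "G_invariant Z2 transposition_action L"
      by (auto simp: G_invariant_def transposition_action_def L_def)
    show "continuous_map K euclideanreal (\<lambda>k. 2 * v k)" by (intro continuous_intros v)
    show "0 \<le> 2 * v k" "2 * v k = 0 \<longleftrightarrow> k \<in> L" if "k \<in> topspace K" for k
      using v_nonneg[OF that] v_L[OF that] by auto
    show "2 * v (transposition_action i k) = 2 * v k" for i k
      by (simp add: transposition_action_def v_swap)
    show "continuous_map (prod_topology K (top_of_set ?I)) K H" using H by (simp add: KI_def)
    show "H (k, 0) = k" if "k \<in> topspace K" for k
      using \<Phi>_start[OF that] by (simp add: H_def \<Phi>_def S0)
    show "H (k, t) = k" if "k \<in> L" "t \<in> ?I" for k t
      using \<Phi>_start[of k] that LK by (auto simp: H_def \<Phi>_def SL)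
    show "H (k, 1) \<in> L" if k: "k \<in> topspace K" "2 * v k < 1" for k
    proof -
      have "l k = 1" using k(2) by (simp add: l_def)
      moreover have "S k 1 \<in> U" using v_W[OF k(1)] k(2) by (auto simp: W_def)
      then have "g (S k 1) \<in> topspace E" using continuous_map_image_subset_topspace[OF g] by auto
      ultimately show ?thesis using k(2) by (auto simp: H_def \<Phi>_def S1 L_def)
    qed
    show "H (transposition_action i k, t) = transposition_action i (H (k, t))" for i k t
      by (auto simp: transposition_action_def H_def \<Phi>_def v_swap l_swap S_swap)
  qed
  have diag: "continuous_map E K (\<lambda>e. (e, e))"
    unfolding K_def by (rule continuous_map_into_fibre_square) auto
  have "embedding_map E K (\<lambda>e. (e, e))"
    unfolding embedding_map_def
  proof (rule homeomorphic_maps_imp_map)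
    show "homeomorphic_maps E (subtopology K ((\<lambda>e. (e, e)) ` topspace E)) (\<lambda>e. (e, e)) fst"
      using diag continuous_map_from_subtopology[OF continuous_map_fst_fibre_square]
      by (auto simp: homeomorphic_maps_def continuous_map_in_subtopology K_def)
  qed
  moreover have "G_space Z2 E (\<lambda>g e. e)"
    using G_space_Z2[of E id] by (simp add: id_def)
  moreover have "G_map Z2 E (\<lambda>g e. e) K transposition_action (\<lambda>e. (e, e))"
    using diag by (simp add: G_map_def transposition_action_def)
  ultimately show ?thesis
    using inclusion unfolding symmetrically_LEC_def closed_G_cofibration_def K_def L_def by blast
qed

theorem proposition2p13:
  fixes E :: "'e topology" and B :: "'b topology" and p :: "'e \<Rightarrow> 'b"
  assumes "locally_trivial_fibration E B p"
    and "ENR_space E"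
    and "separable_space B" and "ANR_space B"
  shows "G_ENR Z2 (fibre_square E p) transposition_action \<and>
         symmetrically_LEC TYPE('y) E p"
proof -
  obtain n \<Omega> h r where "neighbourhood_retract E n \<Omega> h r"
    using assms(2) by (rule ENR_spaceE)
  then interpret neighbourhood_retract E n \<Omega> h r .
  have "metrizable_space B" using assms(4) by (simp add: ANR_space_def G_ANR_def)
  \<comment> \<open>One neighbourhood \<open>U\<close> with one map \<open>g\<close> serves both
    conclusions.\<close>
  with assms(1) show ?thesis
  proof (rule fibre_square_neighbourhood_map)
    fix U g
    assume "openin (top_of_set (topspace (Euclidean_space n) \<times> topspace (Euclidean_space n))) U"
      "\<And>x y. (x, y) \<in> U \<Longrightarrow> (y, x) \<in> U" "continuous_map (top_of_set U) E g"
      "\<And>x y. (x, y) \<in> U \<Longrightarrow> p (g (y, x)) = p (g (x, y))"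
      "\<And>e e'. e \<in> topspace E \<Longrightarrow> e' \<in> topspace E \<Longrightarrow> p e = p e' \<Longrightarrow> (h e, h e') \<in> U \<and> g (h e, h e') = e"
    note U = this
    show ?thesis
      using G_ENR_fibre_square[of U g p] symmetrically_LEC_fibration[of U g p] U by blast
  qed
qed

end
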